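(* Given $x\in\mathbb{R}^n$, suppose that $(y,p)\in S(x)$ and that the basic qualification holds at $y$ for $x$, i.e., $$u\in\partial^\infty h(G(x,y))\ \text{ and }\ \nabla_yG(x,y)^\top u=0\quad\Longrightarrow\quad u=0 .$$ Suppose also that the following condition holds: for all $w\in\mathbb{R}^m$, $z\in\mathbb{R}^s$, $$-\nabla_yG(x,y)^\top z=\nabla^2_{yy}L(x,y,p)w\ \text{ and }\ z\in D^*(\partial h)(G(x,y),p)(\nabla_yG(x,y)w)\quad\Longrightarrow\quad w=0,\ z=0 .$$ Then $S$ is single-valued in a neighborhood of $x$.
   Context: Standing assumptions: $g:\mathbb{R}^n\times\mathbb{R}^m\to\mathbb{R}$ and $G=(g_1,\dots,g_s):\mathbb{R}^n\times\mathbb{R}^m\to\mathbb{R}^s$ are $C^2$; for every $x\in\mathbb{R}^n$, $g(x,\cdot)$ and each $g_i(x,\cdot)$ are convex; $h:\mathbb{R}^s\to[-\infty,\infty]$ is proper, epi-polyhedral (its epigraph is a polyhedral set) and nondecreasing ($z\ge z'$ componentwise implies $h(z)\ge h(z')$). $h^*$ is the convex conjugate of $h$ and $\partial$ denotes the subdifferential. $S(x)$ is the set of $(y,p)\in\mathbb{R}^m\times\mathbb{R}^s$ with $$0=-\nabla_yg(x,y)-\nabla_yG(x,y)^\top p,\qquad 0\in-G(x,y)+\partial h^*(p),$$ where $\nabla_yG$ is the $s\times m$ Jacobian of $G$ in $y$. The Lagrangian is $L(x,y,p)=g(x,y)+\langle G(x,y),p\rangle-h^*(p)$. For a nonempty set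 $C$ and $\bar c\in C$: the tangent cone $T_C(\bar c)$ is the set of limits of $(c^\nu-\bar c)/\tau^\nu$ with $c^\nu\in C$, $\tau^\nu\searrow0$; the regular normal cone $\widehat N_C(\bar c)$ is the polar of $T_C(\bar c)$; the (limiting) normal cone $N_C(\bar c)$ is the set of limits of $u^\nu\in\widehat N_C(c^\nu)$ with $c^\nu\in C$, $c^\nu\to\bar c$. The horizon subdifferential is $\partial^\infty h(z)=\{u\mid(u,0)\in N_{\operatorname{epi}h}(z,h(z))\}$ for $z$ with $h(z)$ finite. For $\bar u\in\partial h(\bar z)$, the coderivative is defined by $z\in D^*(\partial h)(\bar z,\bar u)(v)\iff (z,-v)\in N_{\operatorname{gph}\partial h}(\bar z,\bar u)$, where $\operatorname{gph}\partial h=\{(z,u)\mid u\in\partial h(z)\}$. *)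

theory Defs
  imports "HOL-Analysis.Analysis"
begin

section \<open>Twice continuously differentiable maps and derivatives in coordinates\<close>

definition C2 :: "('a::real_normed_vector \<Rightarrow> 'b::real_normed_vector) \<Rightarrow> bool" where
  "C2 f \<longleftrightarrow> (\<exists>(f' :: 'a \<Rightarrow> 'a \<Rightarrow>\<^sub>L 'b) (f'' :: 'a \<Rightarrow> 'a \<Rightarrow>\<^sub>L ('a \<Rightarrow>\<^sub>L 'b)).
     (\<forall>x. (f has_derivative blinfun_apply (f' x)) (at x)) \<and>
     (\<forall>x. (f' has_derivative blinfun_apply (f'' x)) (at x)) \<and>
     continuous_on UNIV f'')"

definition gradient :: "('a::real_inner \<Rightarrow> real) \<Rightarrow> 'a \<Rightarrow> 'a" where
  "gradient f y = (THE v. GDERIV f y :> v)"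

definition hessian :: "(real^'m \<Rightarrow> real) \<Rightarrow> real^'m \<Rightarrow> real^'m^'m" where
  "hessian f y = jacobian (gradient f) (at y)"

section \<open>Variational geometry\<close>

(* The step sizes only have to be positive with limit 0; passing to a subsequence makes them
   decreasing, so this is the same cone as with monotone step sizes. *)
definition tangent_cone :: "'a::real_normed_vector set \<Rightarrow> 'a \<Rightarrow> 'a set" where
  "tangent_cone C c = {w. \<exists>(cs :: nat \<Rightarrow> 'a) (\<tau> :: nat \<Rightarrow> real).
     (\<forall>k. cs k \<in> C) \<and> (\<forall>k. \<tau> k > 0) \<and> \<tau> \<longlonglongrightarrow> 0 \<and>
     (\<lambda>k. (cs k - c) /\<^sub>R \<tau> k) \<longlonglongrightarrow> w}"

definition polar_cone :: "'a::real_inner set \<Rightarrow> 'a set" where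
  "polar_cone K = {v. \<forall>w\<in>K. v \<bullet> w \<le> 0}"

definition regular_normal_cone :: "'a::real_inner set \<Rightarrow> 'a \<Rightarrow> 'a set" where
  "regular_normal_cone C c = polar_cone (tangent_cone C c)"

definition normal_cone :: "'a::real_inner set \<Rightarrow> 'a \<Rightarrow> 'a set" where
  "normal_cone C c = {u. \<exists>(cs :: nat \<Rightarrow> 'a) (us :: nat \<Rightarrow> 'a).
     (\<forall>k. cs k \<in> C) \<and> cs \<longlonglongrightarrow> c \<and>
     (\<forall>k. us k \<in> regular_normal_cone C (cs k)) \<and> us \<longlonglongrightarrow> u}"

section \<open>Extended-real-valued functions\<close>

definition proper_fun :: "('a \<Rightarrow> ereal) \<Rightarrow> bool" where
  "proper_fun f \<longleftrightarrow> (\<forall>z. f z > -\<infinity>) \<and> (\<exists>z. f z < \<infinity>)"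

definition epi :: "('a \<Rightarrow> ereal) \<Rightarrow> ('a \<times> real) set" where
  "epi f = {(z, t). f z \<le> ereal t}"

definition subdifferential :: "('a::real_inner \<Rightarrow> ereal) \<Rightarrow> 'a \<Rightarrow> 'a set" where
  "subdifferential f z =
     {u. \<bar>f z\<bar> \<noteq> \<infinity> \<and> (u, -1) \<in> normal_cone (epi f) (z, real_of_ereal (f z))}"

definition horizon_subdifferential :: "('a::real_inner \<Rightarrow> ereal) \<Rightarrow> 'a \<Rightarrow> 'a set" where
  "horizon_subdifferential f z =
     {u. \<bar>f z\<bar> \<noteq> \<infinity> \<and> (u, 0) \<in> normal_cone (epi f) (z, real_of_ereal (f z))}"

definition conjugate :: "('a::real_inner \<Rightarrow> ereal) \<Rightarrow> 'a \<Rightarrow> ereal" where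
  "conjugate f p = (SUP z. ereal (z \<bullet> p) - f z)"

definition graph :: "('a \<Rightarrow> 'b set) \<Rightarrow> ('a \<times> 'b) set" where
  "graph F = {(z, u). u \<in> F z}"

definition coderivative ::
    "('a::real_inner \<Rightarrow> 'b::real_inner set) \<Rightarrow> 'a \<Rightarrow> 'b \<Rightarrow> 'b \<Rightarrow> 'a set" where
  "coderivative F z u v = {w. (w, - v) \<in> normal_cone (graph F) (z, u)}"

text \<open>On functions with convex epigraph, the subdifferential defined through normals to the
  epigraph is the usual set of subgradients of convex analysis.\<close>

lemma regular_normal_cone_convex:
  assumes "convex C" "c \<in> C" "u \<in> regular_normal_cone C c" "d \<in> C"
  shows "u \<bullet> (d - c) \<le> 0"
proof -
  define \<tau> where "\<tau> k = inverse (real (Suc k))" for k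
  define cs where "cs k = c + \<tau> k *\<^sub>R (d - c)" for k
  have t: "\<tau> k > 0" "\<tau> k \<le> 1" for k
    by (auto simp: \<tau>_def field_simps)
  have "cs k \<in> C" for k
  proof -
    have "cs k = (1 - \<tau> k) *\<^sub>R c + \<tau> k *\<^sub>R d"
      by (simp add: cs_def algebra_simps)
    moreover have "0 \<le> 1 - \<tau> k" "0 \<le> \<tau> k" "1 - \<tau> k + \<tau> k = 1" using t[of k] by auto
    ultimately show ?thesis using assms(1,2,4) convexD by metis
  qed
  moreover have "\<tau> \<longlonglongrightarrow> 0"
    unfolding \<tau>_def by (rule LIMSEQ_inverse_real_of_nat)
  moreover have "(cs k - c) /\<^sub>R \<tau> k = d - c" for k
    using t[of k] by (simp add: cs_def)
  ultimately have "d - c \<in> tangent_cone C c"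
    unfolding tangent_cone_def using t by (intro CollectI exI[of _ cs] exI[of _ \<tau>]) simp
  then show ?thesis using assms(3) by (simp add: regular_normal_cone_def polar_cone_def)
qed

lemma normal_cone_convex:
  assumes "convex C" "c \<in> C"
  shows "normal_cone C c = {u. \<forall>d\<in>C. u \<bullet> (d - c) \<le> 0}"
proof (intro equalityI subsetI CollectI ballI)
  fix u d assume "u \<in> normal_cone C c" and d: "d \<in> C"
  then obtain cs us where cs: "\<And>k. cs k \<in> C" "cs \<longlonglongrightarrow> c"
    and us: "\<And>k. us k \<in> regular_normal_cone C (cs k)" "us \<longlonglongrightarrow> u"
    unfolding normal_cone_def by blast
  have "(\<lambda>k. us k \<bullet> (d - cs k)) \<longlonglongrightarrow> u \<bullet> (d - c)"
    by (intro tendsto_intros cs us)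
  then show "u \<bullet> (d - c) \<le> 0"
    by (rule LIMSEQ_le_const2) (use regular_normal_cone_convex[OF assms(1) cs(1) us(1) d] in blast)
next
  fix u assume u: "u \<in> {u. \<forall>d\<in>C. u \<bullet> (d - c) \<le> 0}"
  have "u \<bullet> w \<le> 0" if w: "w \<in> tangent_cone C c" for w
  proof -
    obtain cs \<tau> where cs: "\<And>k. cs k \<in> C" "\<And>k. \<tau> k > (0::real)"
      and lim: "(\<lambda>k. (cs k - c) /\<^sub>R \<tau> k) \<longlonglongrightarrow> w"
      using w unfolding tangent_cone_def by blast
    have "(\<lambda>k. u \<bullet> ((cs k - c) /\<^sub>R \<tau> k)) \<longlonglongrightarrow> u \<bullet> w"
      by (intro tendsto_intros lim)
    moreover have "u \<bullet> ((cs k - c) /\<^sub>R \<tau> k) \<le> 0" for k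
      using u cs(1)[of k] cs(2)[of k] by (simp add: mult_nonneg_nonpos)
    ultimately show ?thesis by (meson LIMSEQ_le_const2)
  qed
  then have "u \<in> regular_normal_cone C c"
    by (simp add: regular_normal_cone_def polar_cone_def)
  then show "u \<in> normal_cone C c"
    unfolding normal_cone_def using assms(2)
    by (intro CollectI exI[of _ "\<lambda>_. c"] exI[of _ "\<lambda>_. u"]) simp
qed

lemma subdifferential_convex:
  assumes "convex (epi f)"
  shows "subdifferential f z =
    {u. \<bar>f z\<bar> \<noteq> \<infinity> \<and> (\<forall>z'. f z + ereal (u \<bullet> (z' - z)) \<le> f z')}"
proof (cases "\<bar>f z\<bar> = \<infinity>")
  case True
  then show ?thesis by (simp add: subdifferential_def)
next
  case False
  then obtain r where r: "f z = ereal r" by auto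
  have "(z, r) \<in> epi f" by (simp add: epi_def r)
  note N = normal_cone_convex[OF assms this]
  have "(u, -1) \<in> normal_cone (epi f) (z, r) \<longleftrightarrow>
      (\<forall>z'. f z + ereal (u \<bullet> (z' - z)) \<le> f z')" for u
  proof -
    have "(u, -1) \<in> normal_cone (epi f) (z, r) \<longleftrightarrow>
        (\<forall>z' t. f z' \<le> ereal t \<longrightarrow> r + u \<bullet> (z' - z) \<le> t)"
      unfolding N by (auto simp: epi_def algebra_simps)
    also have "\<dots> \<longleftrightarrow> (\<forall>z'. f z + ereal (u \<bullet> (z' - z)) \<le> f z')"
    proof (intro iffI allI impI)
      fix z' assume "\<forall>z' t. f z' \<le> ereal t \<longrightarrow> r + u \<bullet> (z' - z) \<le> t"
      then have "\<And>t. f z' \<le> ereal t \<Longrightarrow> ereal (r + u \<bullet> (z' - z)) \<le> ereal t" by simp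
      then show "f z + ereal (u \<bullet> (z' - z)) \<le> f z'"
        unfolding r plus_ereal.simps by (rule ereal_le_real)
    next
      fix z' t assume "\<forall>z'. f z + ereal (u \<bullet> (z' - z)) \<le> f z'" "f z' \<le> ereal t"
      then have "ereal (r + u \<bullet> (z' - z)) \<le> ereal t"
        unfolding r plus_ereal.simps using order_trans by blast
      then show "r + u \<bullet> (z' - z) \<le> t" by simp
    qed
    finally show ?thesis .
  qed
  then show ?thesis using r by (simp add: subdifferential_def)
qed

section \<open>The Lagrangian and the solution mapping\<close>

definition lagrangian ::
    "((real^'n) \<times> (real^'m) \<Rightarrow> real) \<Rightarrow> ((real^'n) \<times> (real^'m) \<Rightarrow> real^'s) \<Rightarrow> (real^'s \<Rightarrow> ereal) \<Rightarrow>
     real^'n \<Rightarrow> real^'m \<Rightarrow> real^'s \<Rightarrow> ereal" where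
  "lagrangian g G h x y p = ereal (g (x, y) + G (x, y) \<bullet> p) - conjugate h p"

(* Meaningful where the conjugate of h is finite at p, in particular for every p occurring in
   the solution mapping: there the Lagrangian is real-valued in y. *)
definition hessian_lagrangian ::
    "((real^'n) \<times> (real^'m) \<Rightarrow> real) \<Rightarrow> ((real^'n) \<times> (real^'m) \<Rightarrow> real^'s) \<Rightarrow> (real^'s \<Rightarrow> ereal) \<Rightarrow>
     real^'n \<Rightarrow> real^'m \<Rightarrow> real^'s \<Rightarrow> real^'m^'m" where
  "hessian_lagrangian g G h x y p = hessian (\<lambda>y'. real_of_ereal (lagrangian g G h x y' p)) y"

definition grad_y :: "((real^'n) \<times> (real^'m) \<Rightarrow> real) \<Rightarrow> real^'n \<Rightarrow> real^'m \<Rightarrow> real^'m" where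
  "grad_y g x y = gradient (\<lambda>y'. g (x, y')) y"

definition jac_y :: "((real^'n) \<times> (real^'m) \<Rightarrow> real^'s) \<Rightarrow> real^'n \<Rightarrow> real^'m \<Rightarrow> real^'m^'s" where
  "jac_y G x y = jacobian (\<lambda>y'. G (x, y')) (at y)"

definition solution_mapping ::
    "((real^'n) \<times> (real^'m) \<Rightarrow> real) \<Rightarrow> ((real^'n) \<times> (real^'m) \<Rightarrow> real^'s) \<Rightarrow> (real^'s \<Rightarrow> ereal) \<Rightarrow>
     real^'n \<Rightarrow> ((real^'m) \<times> (real^'s)) set" where
  "solution_mapping g G h x = {(y, p).
     0 = - grad_y g x y - transpose (jac_y G x y) *v p \<and>
     0 \<in> (\<lambda>v. - G (x, y) + v) ` subdifferential (conjugate h) p}"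

end

theory Submission
  imports Defs
begin

text \<open>The pairs in \<open>S(x)\<close> are the solutions of a variational inequality over
  \<open>\<real>\<^sup>m \<times> epi h\<^sup>*\<close> for the map \<open>(y, p, t) \<mapsto> (\<nabla>\<^sub>y L, - G, 1)\<close>; the coordinate \<open>t\<close> is forced to equal
  \<open>h\<^sup>*(p)\<close>. As \<open>h\<close> is nondecreasing, the domain of \<open>h\<^sup>*\<close> lies in the nonnegative orthant, so this map
  is monotone and the solution sets are convex. If solutions are unique near a reference solution for
  all parameters near \<open>x\<close>, then solving the inequality on a small ball (Brouwer) gives existence, the
  limits of these solutions being pinned down by uniqueness at \<open>x\<close>, and convexity makes
  local uniqueness global.

  For local uniqueness, \<open>S(x')\<close> is a product set, being a set of saddle points, so it suffices to
  exclude two nearby solutions that share \<open>p\<close> or share \<open>y\<close>. Since the graph of \<open>\<partial>h\<close> is monotone, two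
  of its points with orthogonal increments yield regular normals to it. Rescaling to unit length and
  passing to the limit gives a nonzero pair \<open>(w, 0)\<close> or \<open>(0, z)\<close> violating the second-order
  condition.\<close>

section \<open>Monotone variational inequalities\<close>

text \<open>For convex \<open>K\<close> this says that \<open>- f u\<close> is normal to
  \<open>K\<close> at \<open>u\<close>: the solution set of a Stampacchia variational
  inequality.\<close>

definition VI :: "'a::real_inner set \<Rightarrow> ('a \<Rightarrow> 'a) \<Rightarrow> 'a set" where
  "VI K f = {u \<in> K. \<forall>v\<in>K. f u \<bullet> (v - u) \<ge> 0}"

definition monotone_map_on :: "'a::real_inner set \<Rightarrow> ('a \<Rightarrow> 'a) \<Rightarrow> bool" where
  "monotone_map_on K f \<longleftrightarrow> (\<forall>u\<in>K. \<forall>v\<in>K. (f u - f v) \<bullet> (u - v) \<ge> 0)"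

text \<open>A point solves the inequality iff it is fixed by projecting \<open>u - f u\<close> back
  onto \<open>K\<close>. This projection map is a continuous self-map of \<open>K\<close>, so
  Brouwer's theorem applies.\<close>

lemma VI_nonempty:
  fixes K :: "'a::euclidean_space set"
  assumes "compact K" "convex K" "K \<noteq> {}" "continuous_on K f"
  shows "VI K f \<noteq> {}"
proof -
  have cl: "closed K" using assms(1) compact_imp_closed by blast
  obtain u where u: "u \<in> K" "closest_point K (u - f u) = u"
  proof (rule brouwer[OF assms(1-3), of "\<lambda>u. closest_point K (u - f u)"])
    have "continuous_on UNIV (closest_point K)"
      using continuous_on_closest_point[OF assms(2) cl assms(3)] .
    then show "continuous_on K (\<lambda>u. closest_point K (u - f u))"
      by (rule continuous_on_compose2) (auto intro!: continuous_intros assms(4))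
    show "(\<lambda>u. closest_point K (u - f u)) \<in> K \<rightarrow> K"
      using closest_point_in_set[OF cl assms(3)] by auto
  qed
  have "f u \<bullet> (v - u) \<ge> 0" if "v \<in> K" for v
    using closest_point_dot[OF assms(2) cl that, of "u - f u"] u(2) by simp
  with u(1) show ?thesis by (auto simp: VI_def)
qed

text \<open>From a point strictly inside the ball, a short step towards any \<open>v\<close> in
  \<open>C\<close> stays in the ball, and shortening the step does not change the sign of
  \<open>f u \<bullet> (v - u)\<close>.\<close>

lemma VI_Int_cball_imp_VI:
  assumes "convex C" "u \<in> VI (C \<inter> cball a r) f" "dist a u < r"
  shows "u \<in> VI C f"
proof -
  have uC: "u \<in> C" and le: "\<And>v. v \<in> C \<Longrightarrow> dist a v \<le> r \<Longrightarrow> f u \<bullet> (v - u) \<ge> 0"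
    using assms(2) by (auto simp: VI_def)
  have "f u \<bullet> (v - u) \<ge> 0" if v: "v \<in> C" for v
  proof -
    \<comment> \<open>The step from \<open>u\<close> has length at most \<open>r - dist a u\<close>;
      the 1 in the denominator covers \<open>v = u\<close>.\<close>
    define s where "s = min 1 ((r - dist a u) / (1 + norm (v - u)))"
    have n: "1 + norm (v - u) > 0" by (smt (verit) norm_ge_zero)
    have s: "0 < s" "s \<le> 1" using assms(3) n by (auto simp: s_def)
    have "s * norm (v - u) \<le> s * (1 + norm (v - u))" using s by simp
    also have "\<dots> \<le> (r - dist a u) / (1 + norm (v - u)) * (1 + norm (v - u))"
      by (rule mult_right_mono) (use n in \<open>auto simp: s_def\<close>)
    finally have sn: "s * norm (v - u) \<le> r - dist a u" using n by simp
    let ?w = "u + s *\<^sub>R (v - u)"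
    have "?w = (1 - s) *\<^sub>R u + s *\<^sub>R v" by (simp add: algebra_simps)
    then have "?w \<in> C" using s uC v assms(1) by (simp add: convex_alt)
    moreover have "dist a ?w \<le> r"
    proof -
      have "dist a ?w \<le> dist a u + dist u ?w" by (rule dist_triangle)
      also have "dist u ?w = s * norm (v - u)" using s by (simp add: dist_norm)
      finally show ?thesis using sn by simp
    qed
    ultimately have "s * (f u \<bullet> (v - u)) \<ge> 0" using le[of ?w] by simp
    then show ?thesis using s by (simp add: zero_le_mult_iff)
  qed
  then show ?thesis using uC by (auto simp: VI_def)
qed

lemma VI_subset: "u \<in> VI C f \<Longrightarrow> u \<in> K \<Longrightarrow> K \<subseteq> C \<Longrightarrow> u \<in> VI K f"
  by (auto simp: VI_def)

text \<open>Minty's reformulation: evaluating \<open>f\<close> at the test point instead of at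
  \<open>u\<close> makes the conditions affine in \<open>u\<close>. Monotonicity gives one
  inclusion; testing at points that tend to \<open>u\<close> along a segment gives the
  other.\<close>

lemma VI_Minty:
  assumes "convex K" "continuous_on K f" "monotone_map_on K f"
  shows "VI K f = {u \<in> K. \<forall>v\<in>K. f v \<bullet> (v - u) \<ge> 0}"
proof (intro equalityI subsetI CollectI conjI ballI)
  fix u v assume u: "u \<in> VI K f" and v: "v \<in> K"
  then have "f u \<bullet> (v - u) \<ge> 0" "u \<in> K" by (auto simp: VI_def)
  moreover have "(f v - f u) \<bullet> (v - u) \<ge> 0"
    using assms(3) v \<open>u \<in> K\<close> by (simp add: monotone_map_on_def)
  ultimately show "f v \<bullet> (v - u) \<ge> 0" by (simp add: inner_diff_left)
next
  fix u assume "u \<in> VI K f" then show "u \<in> K" by (simp add: VI_def)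
next
  fix u assume "u \<in> {u \<in> K. \<forall>v\<in>K. f v \<bullet> (v - u) \<ge> 0}"
  then have uK: "u \<in> K" and u: "\<And>v. v \<in> K \<Longrightarrow> f v \<bullet> (v - u) \<ge> 0" by auto
  have "f u \<bullet> (v - u) \<ge> 0" if v: "v \<in> K" for v
  proof -
    define \<tau> where "\<tau> k = inverse (real (Suc k))" for k
    have t: "0 < \<tau> k" "\<tau> k \<le> 1" for k by (auto simp: \<tau>_def field_simps)
    have \<tau>: "\<tau> \<longlonglongrightarrow> 0" unfolding \<tau>_def by (rule LIMSEQ_inverse_real_of_nat)
    define w where "w k = u + \<tau> k *\<^sub>R (v - u)" for k
    have "w k = (1 - \<tau> k) *\<^sub>R u + \<tau> k *\<^sub>R v" for k by (simp add: w_def algebra_simps)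
    then have wK: "w k \<in> K" for k using t[of k] uK v assms(1) by (simp add: convex_alt)
    have "w \<longlonglongrightarrow> u + 0 *\<^sub>R (v - u)"
      unfolding w_def by (intro tendsto_intros \<tau>)
    then have "w \<longlonglongrightarrow> u" by simp
    then have "(\<lambda>k. f (w k)) \<longlonglongrightarrow> f u"
      using assms(2) uK wK by (simp add: continuous_on_sequentially comp_def)
    then have "(\<lambda>k. f (w k) \<bullet> (v - u)) \<longlonglongrightarrow> f u \<bullet> (v - u)" by (intro tendsto_intros)
    moreover have "f (w k) \<bullet> (v - u) \<ge> 0" for k
    proof -
      have "\<tau> k * (f (w k) \<bullet> (v - u)) \<ge> 0" using u[OF wK, of k] by (simp add: w_def)
      then show ?thesis using t(1)[of k] by (simp add: zero_le_mult_iff)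
    qed
    ultimately show ?thesis by (meson LIMSEQ_le_const)
  qed
  with uK show "u \<in> VI K f" by (simp add: VI_def)
qed

text \<open>In Minty's form each test point contributes one halfspace.\<close>

lemma convex_VI:
  assumes "convex K" "continuous_on K f" "monotone_map_on K f"
  shows "convex (VI K f)"
proof -
  have "VI K f = K \<inter> (\<Inter>v\<in>K. {u. f v \<bullet> u \<le> f v \<bullet> v})"
    unfolding VI_Minty[OF assms] by (auto simp: inner_diff_right)
  then show ?thesis
    using assms(1) by (auto intro!: convex_Int convex_INT convex_halfspace_le)
qed

text \<open>A second point of \<open>T\<close> would put a whole segment into \<open>T\<close>, and
  its part close to \<open>u\<close> lies in the ball where \<open>u\<close> is the only
  point.\<close>

lemma unique_of_locally_unique:
  fixes T :: "'a::real_normed_vector set"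
  assumes "convex T" "u \<in> T" "dist u0 u < e"
    and loc: "\<And>v. v \<in> T \<Longrightarrow> dist u0 v < e \<Longrightarrow> v = u"
    and "v \<in> T"
  shows "v = u"
proof (rule ccontr)
  assume ne: "v \<noteq> u"
  then have n: "norm (v - u) > 0" by simp
  \<comment> \<open>The factor 2 keeps the point on the segment strictly inside the ball.\<close>
  define s where "s = min 1 ((e - dist u0 u) / (2 * norm (v - u)))"
  have s: "0 < s" "s \<le> 1" using assms(3) n by (auto simp: s_def)
  have "s * norm (v - u) \<le> (e - dist u0 u) / (2 * norm (v - u)) * norm (v - u)"
    by (rule mult_right_mono) (auto simp: s_def)
  also have "\<dots> = (e - dist u0 u) / 2" using n by simp
  finally have sn: "s * norm (v - u) \<le> (e - dist u0 u) / 2" .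
  let ?w = "u + s *\<^sub>R (v - u)"
  have "?w = (1 - s) *\<^sub>R u + s *\<^sub>R v" by (simp add: algebra_simps)
  then have "?w \<in> T" using s assms(1,2,5) by (simp add: convex_alt)
  moreover have "dist u0 ?w < e"
  proof -
    have "dist u0 ?w \<le> dist u0 u + dist u ?w" by (rule dist_triangle)
    also have "dist u ?w = s * norm (v - u)" using s by (simp add: dist_norm)
    finally show ?thesis using sn assms(3) by simp
  qed
  ultimately have "?w = u" by (rule loc)
  with s ne show False by simp
qed

lemma LIMSEQ_of_dist_less:
  assumes "\<And>k. dist l (X k) < inverse (real (Suc k))"
  shows "X \<longlonglongrightarrow> l"
proof (subst tendsto_dist_iff, rule tendsto_sandwich[OF _ _ tendsto_const LIMSEQ_inverse_real_of_nat])
  show "\<forall>\<^sub>F k in sequentially. 0 \<le> dist (X k) l" by simp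
  show "\<forall>\<^sub>F k in sequentially. dist (X k) l \<le> inverse (real (Suc k))"
    by (subst dist_commute, intro always_eventually allI less_imp_le assms)
qed

text \<open>Existence comes from the problem on a small ball around \<open>u0\<close>: its solutions
  stay off the bounding sphere for \<open>x\<close> near \<open>x0\<close>, so they solve the
  problem on \<open>C\<close>. Uniqueness in the ball spreads to \<open>C\<close> because the
  solution set is convex.\<close>

theorem VI_unique_near:
  fixes C :: "'a::euclidean_space set" and F :: "'x::metric_space \<Rightarrow> 'a \<Rightarrow> 'a"
  assumes C: "convex C" "closed C"
    and cont: "continuous_on (UNIV \<times> C) (\<lambda>(x, u). F x u)"
    and mono: "\<And>x. monotone_map_on C (F x)"
    and u0: "u0 \<in> VI C (F x0)"
    and "e > 0"
    and loc: "\<And>x u v. dist x0 x < e \<Longrightarrow> u \<in> VI C (F x) \<Longrightarrow> v \<in> VI C (F x) \<Longrightarrow>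
                dist u0 u < e \<Longrightarrow> dist u0 v < e \<Longrightarrow> u = v"
  shows "\<exists>U. open U \<and> x0 \<in> U \<and> (\<forall>x\<in>U. \<exists>!u. u \<in> VI C (F x))"
proof -
  define r where "r = e / 2"
  have r: "0 < r" "r < e" using \<open>e > 0\<close> by (auto simp: r_def)
  define K where "K = C \<inter> cball u0 r"
  have K: "convex K" "compact K" "K \<subseteq> C" "u0 \<in> K" "K \<noteq> {}"
    using C u0 r by (auto simp: K_def VI_def convex_Int closed_Int_compact)
  have contC: "continuous_on C (F x)" for x
    using continuous_on_compose2[OF cont, of C "\<lambda>u. (x, u)"]
    by (simp add: continuous_on_Pair image_subset_iff)
  have contK: "continuous_on K (F x)" for x
    using contC K(3) continuous_on_subset by blast
  have monoK: "monotone_map_on K (F x)" for x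
    using mono[of x] K(3) by (auto simp: monotone_map_on_def)
  \<comment> \<open>Solutions inside the ball solve the problem on \<open>C\<close> and fall under
    \<open>loc\<close>; convexity of the solution set then excludes solutions on the sphere as
    well.\<close>
  have sol0: "u = u0" if u: "u \<in> VI K (F x0)" for u
  proof (rule unique_of_locally_unique[OF convex_VI[OF K(1) contK monoK, of x0]])
    show "u0 \<in> VI K (F x0)" using VI_subset u0 K by blast
    show "dist u0 u0 < r" using r by simp
    show "u \<in> VI K (F x0)" by (rule u)
    fix v assume "v \<in> VI K (F x0)" "dist u0 v < r"
    then have "v \<in> VI C (F x0)" using VI_Int_cball_imp_VI[OF C(1)] K_def by blast
    then show "v = u0" using loc[of x0 v u0] u0 \<open>dist u0 v < r\<close> r by simp
  qed
  \<comment> \<open>Otherwise there are solutions on or beyond the sphere of radius \<open>r\<close>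
    for parameters tending to \<open>x0\<close>. A cluster point solves the problem at
    \<open>x0\<close> and still has distance at least \<open>r\<close> from \<open>u0\<close>,
    against \<open>sol0\<close>.\<close>
  have "\<exists>d>0. \<forall>x. dist x0 x < d \<longrightarrow> (\<forall>u\<in>VI K (F x). dist u0 u < r)"
  proof (rule ccontr)
    assume "\<not> ?thesis"
    then have "\<exists>x u. dist x0 x < inverse (real (Suc k)) \<and> u \<in> VI K (F x) \<and> dist u0 u \<ge> r" for k
      by (metis inverse_positive_iff_positive not_le of_nat_0_less_iff zero_less_Suc)
    then obtain X A where X: "\<And>k. dist x0 (X k) < inverse (real (Suc k))"
      and A: "\<And>k. A k \<in> VI K (F (X k))" and far: "\<And>k. dist u0 (A k) \<ge> r"
      by metis
    have "X \<longlonglongrightarrow> x0" using LIMSEQ_of_dist_less X by blast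
    have AK: "A k \<in> K" for k using A by (simp add: VI_def)
    obtain u \<rho> where u: "u \<in> K" and \<rho>: "strict_mono (\<rho>::nat \<Rightarrow> nat)" and lim: "(A \<circ> \<rho>) \<longlonglongrightarrow> u"
      using K(2) AK unfolding compact_def by metis
    have limX: "(X \<circ> \<rho>) \<longlonglongrightarrow> x0" using \<open>X \<longlonglongrightarrow> x0\<close> \<rho> LIMSEQ_subseq_LIMSEQ by blast
    have "(\<lambda>k. (X (\<rho> k), A (\<rho> k))) \<longlonglongrightarrow> (x0, u)"
      using lim limX by (auto intro!: tendsto_Pair simp: comp_def)
    moreover have "(X (\<rho> k), A (\<rho> k)) \<in> UNIV \<times> C" for k
      using AK K(3) by blast
    moreover have "(x0, u) \<in> UNIV \<times> C" using u K(3) by blast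
    ultimately have "((\<lambda>(x, u). F x u) \<circ> (\<lambda>k. (X (\<rho> k), A (\<rho> k)))) \<longlonglongrightarrow>
        (\<lambda>(x, u). F x u) (x0, u)"
      by (intro cont[unfolded continuous_on_sequentially, THEN spec, THEN bspec, THEN mp] conjI allI)
    then have limF: "(\<lambda>k. F (X (\<rho> k)) (A (\<rho> k))) \<longlonglongrightarrow> F x0 u"
      by (simp add: comp_def)
    have "F x0 u \<bullet> (v - u) \<ge> 0" if v: "v \<in> K" for v
    proof -
      have "(\<lambda>k. F (X (\<rho> k)) (A (\<rho> k)) \<bullet> (v - A (\<rho> k))) \<longlonglongrightarrow> F x0 u \<bullet> (v - u)"
        using lim by (intro tendsto_intros limF) (simp add: comp_def)
      moreover have "F (X (\<rho> k)) (A (\<rho> k)) \<bullet> (v - A (\<rho> k)) \<ge> 0" for k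
        using A[of "\<rho> k"] v by (simp add: VI_def)
      ultimately show ?thesis by (meson LIMSEQ_le_const)
    qed
    then have "u = u0" using sol0 u by (simp add: VI_def)
    moreover have "dist u0 u \<ge> r"
    proof -
      have "(\<lambda>k. dist u0 (A (\<rho> k))) \<longlonglongrightarrow> dist u0 u"
        using lim by (intro tendsto_intros) (simp add: comp_def)
      then show ?thesis using far by (meson LIMSEQ_le_const)
    qed
    ultimately show False using r by simp
  qed
  then obtain d where d: "d > 0"
    "\<And>x u. dist x0 x < d \<Longrightarrow> u \<in> VI K (F x) \<Longrightarrow> dist u0 u < r" by blast
  have "\<exists>!u. u \<in> VI C (F x)" if x: "x \<in> ball x0 (min d e)" for x
  proof -
    obtain u where uK: "u \<in> VI K (F x)" using VI_nonempty[OF K(2,1,5) contK] by blast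
    have ur: "dist u0 u < r" using d(2)[OF _ uK] x by simp
    have u: "u \<in> VI C (F x)" using VI_Int_cball_imp_VI[OF C(1)] uK ur K_def by blast
    show ?thesis
    proof (rule ex1I[of _ u])
      show "u \<in> VI C (F x)" by (rule u)
    next
      fix v assume v: "v \<in> VI C (F x)"
      show "v = u"
      \<comment> \<open>Here \<open>v\<close> may lie far from \<open>u0\<close>; only the
        comparison points \<open>w\<close> are close.\<close>
      proof (rule unique_of_locally_unique[OF convex_VI[OF C(1) contC mono] u _ _ v])
        show "dist u0 u < e" using ur r by simp
        show "w = u" if "w \<in> VI C (F x)" "dist u0 w < e" for w
          using loc[of x w u] that u ur r x by simp
      qed
    qed
  qed
  then show ?thesis
    using d(1) \<open>e > 0\<close> by (intro exI[of _ "ball x0 (min d e)"]) auto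
qed

section \<open>Calculus\<close>

text \<open>Restriction to the line through \<open>y\<close> and \<open>z\<close> reduces this to
  the tangent inequality for convex functions of one real variable.\<close>

lemma convex_on_UNIV_above_tangent:
  fixes f :: "'a::real_normed_vector \<Rightarrow> real"
  assumes "convex_on UNIV f" "(f has_derivative f') (at y)"
  shows "f y + f' (z - y) \<le> f z"
proof -
  let ?l = "\<lambda>s::real. y + s *\<^sub>R (z - y)"
  have "convex_on UNIV (\<lambda>s. f (?l s))"
  proof (rule convex_onI)
    fix t a b :: real assume t: "0 < t" "t < 1"
    have "?l ((1 - t) *\<^sub>R a + t *\<^sub>R b) = (1 - t) *\<^sub>R ?l a + t *\<^sub>R ?l b"
      by (simp add: algebra_simps)
    then show "f (?l ((1 - t) *\<^sub>R a + t *\<^sub>R b)) \<le> (1 - t) * f (?l a) + t * f (?l b)"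
      using convex_onD[OF assms(1), of t "?l a" "?l b"] t by simp
  qed simp
  moreover have "((\<lambda>s. f (?l s)) has_derivative (\<lambda>s. f' (s *\<^sub>R (z - y)))) (at 0)"
    by (rule has_derivative_compose[of ?l]) (auto intro!: derivative_eq_intros assms(2))
  then have "((\<lambda>s. f (?l s)) has_real_derivative f' (z - y)) (at 0)"
    unfolding has_field_derivative_def
    using linear_cmul[OF has_derivative_linear[OF assms(2)]] by (simp add: mult.commute[of _ "f' (z - y)"])
  ultimately have "f (?l 1) - f (?l 0) \<ge> f' (z - y) * (1 - 0)"
    by (intro convex_on_imp_above_tangent[where A = UNIV]) auto
  then show ?thesis by simp
qed

text \<open>Both end points move, so this is strict differentiability at \<open>c\<close>.
  Continuity of \<open>f'\<close> at \<open>c\<close> makes \<open>f'\<close> nearly constant on a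
  ball, and the mean value inequality on the segment from \<open>a k\<close> to \<open>b k\<close>
  bounds the remainder.\<close>

lemma difference_quotient_sequence_limit:
  fixes f :: "'a::real_normed_vector \<Rightarrow> 'b::real_normed_vector"
    and f' :: "'a \<Rightarrow> 'a \<Rightarrow>\<^sub>L 'b"
  assumes f': "\<And>x. (f has_derivative blinfun_apply (f' x)) (at x)"
    and cont: "isCont f' c"
    and a: "a \<longlonglongrightarrow> c" and b: "b \<longlonglongrightarrow> c" and ne: "\<And>k. a k \<noteq> b k"
    and d: "(\<lambda>k. (b k - a k) /\<^sub>R norm (b k - a k)) \<longlonglongrightarrow> d"
  shows "(\<lambda>k. (f (b k) - f (a k)) /\<^sub>R norm (b k - a k)) \<longlonglongrightarrow> blinfun_apply (f' c) d"
proof -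
  let ?q = "\<lambda>k. (f (b k) - f (a k)) /\<^sub>R norm (b k - a k)"
  let ?l = "\<lambda>k. blinfun_apply (f' c) ((b k - a k) /\<^sub>R norm (b k - a k))"
  have "(\<lambda>k. ?q k - ?l k) \<longlonglongrightarrow> 0"
  proof (rule LIMSEQ_I)
    fix e :: real assume "e > 0"
    then obtain r where r: "r > 0" "\<And>x. dist x c < r \<Longrightarrow> dist (f' x) (f' c) < e / 2"
      using cont unfolding continuous_at_eps_delta by (meson half_gt_zero)
    have "\<forall>\<^sub>F k in sequentially. dist (a k) c < r \<and> dist (b k) c < r"
      using a b r(1) by (intro eventually_conj tendstoD)
    then obtain N where N: "\<And>k. k \<ge> N \<Longrightarrow> dist (a k) c < r \<and> dist (b k) c < r"
      by (auto simp: eventually_sequentially)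
    have "norm (?q k - ?l k) < e" if k: "k \<ge> N" for k
    proof -
      have seg: "a k + t *\<^sub>R (b k - a k) \<in> ball c r" if "t \<in> {0..1}" for t
      proof -
        have "a k + t *\<^sub>R (b k - a k) = (1 - t) *\<^sub>R a k + t *\<^sub>R b k"
          by (simp add: algebra_simps)
        moreover have "a k \<in> ball c r" "b k \<in> ball c r"
          using N[OF k] by (auto simp: dist_commute)
        ultimately show ?thesis
          using that convex_ball[of c r] by (simp add: convex_alt)
      qed
      have "norm (f (b k) - f (a k) - f' c (b k - a k)) \<le> norm (b k - a k) * (e / 2)"
      proof (rule differentiable_bound_linearization[where f' = "\<lambda>x. blinfun_apply (f' x)" and S = "ball c r", OF seg])
        show "(f has_derivative blinfun_apply (f' x)) (at x within ball c r)" for x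
          by (rule has_derivative_at_withinI[OF f'])
        show "onorm (blinfun_apply (f' x) - blinfun_apply (f' c)) \<le> e / 2" if "x \<in> ball c r" for x
        proof -
          have "blinfun_apply (f' x) - blinfun_apply (f' c) = blinfun_apply (f' x - f' c)"
            by (auto simp: blinfun.diff_left)
          then show ?thesis
            using r(2)[of x] that
            by (simp add: norm_blinfun.rep_eq[symmetric] dist_norm norm_minus_commute)
        qed
      qed (use r in auto)
      moreover have "norm (?q k - ?l k) = norm (f (b k) - f (a k) - f' c (b k - a k)) / norm (b k - a k)"
      proof -
        have "?q k - ?l k = (f (b k) - f (a k) - f' c (b k - a k)) /\<^sub>R norm (b k - a k)"
          by (simp only: blinfun.scaleR_right) (simp only: scaleR_diff_right)
        then show ?thesis by (simp only: norm_scaleR) (simp add: divide_inverse)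
      qed
      moreover have "norm (b k - a k) > 0" using ne[of k] by simp
      ultimately have "norm (?q k - ?l k) \<le> e / 2"
        by (simp only: pos_divide_le_eq mult.commute)
      then show ?thesis using \<open>e > 0\<close> by simp
    qed
    then show "\<exists>N. \<forall>k\<ge>N. norm (?q k - ?l k - 0) < e" by auto
  qed
  moreover have "?l \<longlonglongrightarrow> blinfun_apply (f' c) d"
    by (intro tendsto_intros d)
  ultimately have "(\<lambda>k. ?q k - ?l k + ?l k) \<longlonglongrightarrow> 0 + blinfun_apply (f' c) d"
    by (rule tendsto_add)
  then show ?thesis by simp
qed

text \<open>Compactness of the unit sphere; the limit directions are the candidates to be tested in
  the second-order condition.\<close>

lemma normalized_difference_convergent_subseq:
  fixes a b :: "nat \<Rightarrow> 'a::euclidean_space"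
  assumes "\<And>k. a k \<noteq> b k"
  obtains \<rho> d where "strict_mono (\<rho> :: nat \<Rightarrow> nat)" "norm d = 1"
    "(\<lambda>k. (b (\<rho> k) - a (\<rho> k)) /\<^sub>R norm (b (\<rho> k) - a (\<rho> k))) \<longlonglongrightarrow> d"
proof -
  let ?d = "\<lambda>k. (b k - a k) /\<^sub>R norm (b k - a k)"
  have "\<forall>k. ?d k \<in> sphere 0 1" using assms[symmetric] by simp
  from compact_sphere[unfolded compact_def, THEN spec, THEN mp, OF this]
  obtain d \<rho> where "d \<in> sphere 0 1" "strict_mono \<rho>" "(?d \<circ> \<rho>) \<longlonglongrightarrow> d" by blast
  then show thesis by (intro that[of \<rho> d]) (auto simp: comp_def)
qed

section \<open>Gradients and partial derivatives in coordinates\<close>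

lemma gradient_eqI:
  assumes "GDERIV f y :> v"
  shows "gradient f y = v"
  unfolding gradient_def
proof (rule the_equality[where P = "\<lambda>v. GDERIV f y :> v", OF assms])
  fix w assume "GDERIV f y :> w"
  then have "(\<lambda>h. h \<bullet> w) = (\<lambda>h. h \<bullet> v)"
    using assms has_derivative_unique unfolding gderiv_def by blast
  then have "(w - v) \<bullet> w = (w - v) \<bullet> v" by (rule fun_cong)
  then have "(w - v) \<bullet> (w - v) = 0" by (simp add: inner_diff_right)
  then show "w = v" by simp
qed

lemma has_derivative_slice:
  assumes "(f has_derivative f') (at (x, y))"
  shows "((\<lambda>y'. f (x, y')) has_derivative (\<lambda>w. f' (0, w))) (at y)"
  by (rule has_derivative_compose[of "Pair x"])
     (auto intro!: derivative_eq_intros assms)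

lemma linear_slice:
  fixes A :: "('a::real_normed_vector \<times> 'b::real_normed_vector) \<Rightarrow>\<^sub>L 'c::real_normed_vector"
  shows "linear (\<lambda>w. blinfun_apply A (0, w))"
proof
  fix v w :: 'b and r :: real
  show "A (0, v + w) = A (0, v) + A (0, w)" using blinfun.add_right[of A "(0, v)" "(0, w)"] by simp
  show "A (0, r *\<^sub>R v) = r *\<^sub>R A (0, v)" using blinfun.scaleR_right[of A r "(0, v)"] by simp
qed

text \<open>Riesz representation in coordinates: it supplies the vectors that serve as gradients and
  as values of the Hessian.\<close>

lemma inner_representation:
  fixes l :: "real^'m \<Rightarrow> real"
  assumes "linear l"
  shows "(\<chi> i. l (axis i 1)) \<bullet> v = l v"
proof -
  have "l v = l (\<Sum>i\<in>UNIV. v $ i *\<^sub>R axis i 1)"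
    by (simp add: scalar_mult_eq_scaleR[symmetric] basis_expansion)
  also have "\<dots> = (\<Sum>i\<in>UNIV. v $ i * l (axis i 1))"
    using assms by (simp add: linear_sum linear_cmul)
  finally show ?thesis by (simp add: inner_vec_def mult.commute)
qed

section \<open>Conjugates and subdifferentials\<close>

text \<open>The Fenchel-Young inequality in terms of epigraphs. It exhibits the set as an
  intersection of closed halfspaces and replaces extended-real arithmetic by real
  inequalities.\<close>

lemma epi_conjugate:
  "epi (conjugate h) = (\<Inter>(z, s)\<in>epi h. {(p, t). z \<bullet> p - s \<le> t})"
proof (intro equalityI subsetI)
  fix u assume u: "u \<in> epi (conjugate h)"
  obtain p t where [simp]: "u = (p, t)" by force
  have "z \<bullet> p - s \<le> t" if "h z \<le> ereal s" for z s
  proof -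
    have "ereal (z \<bullet> p) - ereal s \<le> ereal (z \<bullet> p) - h z"
      using that by (intro ereal_minus_mono) auto
    also have "\<dots> \<le> conjugate h p" unfolding conjugate_def by (rule SUP_upper) simp
    also have "\<dots> \<le> ereal t" using u by (simp add: epi_def)
    finally show ?thesis by simp
  qed
  then show "u \<in> (\<Inter>(z, s)\<in>epi h. {(p, t). z \<bullet> p - s \<le> t})" by (auto simp: epi_def)
next
  fix u assume u: "u \<in> (\<Inter>(z, s)\<in>epi h. {(p, t). z \<bullet> p - s \<le> t})"
  obtain p t where [simp]: "u = (p, t)" by force
  have le: "z \<bullet> p - s \<le> t" if "h z \<le> ereal s" for z s
    using u that by (fastforce simp: epi_def)
  have "ereal (z \<bullet> p) - h z \<le> ereal t" for z
  proof (cases "h z")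
    case (real r)
    then show ?thesis using le[of z r] by simp
  next
    case MInf
    \<comment> \<open>If \<open>h z\<close> is minus infinity, every real \<open>s\<close> is
      admissible in \<open>le\<close>; this one yields \<open>t + 1 \<le> t\<close>.\<close>
    then show ?thesis using le[of z "z \<bullet> p - t - 1"] by simp
  qed simp
  then show "u \<in> epi (conjugate h)" by (simp add: epi_def conjugate_def SUP_least)
qed

lemma epi_conjugateD:
  assumes "conjugate h p \<le> ereal t" "h z \<le> ereal s"
  shows "z \<bullet> p \<le> s + t"
proof -
  have "(p, t) \<in> epi (conjugate h)" "(z, s) \<in> epi h" using assms by (auto simp: epi_def)
  then show ?thesis unfolding epi_conjugate by fastforce
qed

lemma epi_conjugateI:
  assumes "\<And>z s. h z \<le> ereal s \<Longrightarrow> z \<bullet> p \<le> s + t"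
  shows "conjugate h p \<le> ereal t"
proof -
  have "(p, t) \<in> epi (conjugate h)"
    unfolding epi_conjugate using assms by (fastforce simp: epi_def)
  then show ?thesis by (simp add: epi_def)
qed

lemma convex_epi_conjugate: "convex (epi (conjugate h))"
proof -
  have "{(p, t). z \<bullet> p - s \<le> t} = {u. (z, -1) \<bullet> u \<le> s}" for z :: 'a and s :: real
    by auto
  then show ?thesis
    unfolding epi_conjugate by (auto intro!: convex_INT simp: convex_halfspace_le)
qed

lemma closed_epi_conjugate: "closed (epi (conjugate h))"
proof -
  have "{(p, t). z \<bullet> p - s \<le> t} = {u. (z, -1) \<bullet> u \<le> s}" for z :: 'a and s :: real
    by auto
  then show ?thesis
    unfolding epi_conjugate by (auto intro!: closed_INT simp: closed_halfspace_le)
qed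

lemma proper_fun_epi_nonempty:
  assumes "proper_fun h"
  obtains z s where "h z = ereal s"
  using assms unfolding proper_fun_def by (metis ereal_less_PInfty less_ereal.simps(2,3) ereal_cases)

lemma conjugate_not_MInf:
  assumes "proper_fun h"
  shows "conjugate h p \<noteq> -\<infinity>"
proof
  assume "conjugate h p = -\<infinity>"
  moreover obtain z s where "h z = ereal s" using proper_fun_epi_nonempty[OF assms] .
  ultimately show False using epi_conjugateD[of h p "z \<bullet> p - s - 1" z s] by simp
qed

text \<open>If \<open>p $ i\<close> were negative, moving a point down along the \<open>i\<close>-th
  axis would not raise \<open>h\<close> but would make the inner product with \<open>p\<close>
  unbounded.\<close>

lemma mono_conjugate_nonneg:
  fixes h :: "real^'s \<Rightarrow> ereal"
  assumes "proper_fun h" "mono h" "conjugate h p \<le> ereal t"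
  shows "p $ i \<ge> 0"
proof (rule ccontr)
  assume neg: "\<not> ?thesis"
  obtain z s where z: "h z = ereal s" using proper_fun_epi_nonempty[OF assms(1)] .
  \<comment> \<open>Large enough to violate Fenchel-Young by 1; the maximum with 0 makes the move go
    downwards.\<close>
  define \<alpha> where "\<alpha> = max 0 ((s + t - z \<bullet> p + 1) / (- p $ i))"
  have "z - \<alpha> *\<^sub>R axis i 1 \<le> z"
    by (auto simp: less_eq_vec_def axis_def \<alpha>_def)
  then have "h (z - \<alpha> *\<^sub>R axis i 1) \<le> ereal s" using monoD[OF assms(2)] z by metis
  from epi_conjugateD[OF assms(3) this]
  have "z \<bullet> p + \<alpha> * (- p $ i) \<le> s + t" by (simp add: inner_diff_left inner_axis')
  moreover have "\<alpha> * (- p $ i) \<ge> (s + t - z \<bullet> p + 1) / (- p $ i) * (- p $ i)"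
    using neg by (intro mult_right_mono) (auto simp: \<alpha>_def)
  then have "\<alpha> * (- p $ i) \<ge> s + t - z \<bullet> p + 1" using neg by simp
  ultimately show False by simp
qed

text \<open>Testing on points of the epigraph instead of on values of the conjugate keeps the
  subgradient inequality real.\<close>

lemma subdifferential_conjugate_iff:
  assumes "proper_fun h"
  shows "z \<in> subdifferential (conjugate h) p \<longleftrightarrow>
    (\<exists>t. conjugate h p = ereal t \<and> (\<forall>(p', t')\<in>epi (conjugate h). t + z \<bullet> (p' - p) \<le> t'))"
proof -
  have "(\<forall>p'. ereal (t + z \<bullet> (p' - p)) \<le> conjugate h p') \<longleftrightarrow>
      (\<forall>(p', t')\<in>epi (conjugate h). t + z \<bullet> (p' - p) \<le> t')" for t
  proof (intro iffI ballI allI)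
    fix u assume a: "\<forall>p'. ereal (t + z \<bullet> (p' - p)) \<le> conjugate h p'" "u \<in> epi (conjugate h)"
    obtain p' t' where [simp]: "u = (p', t')" by force
    have "ereal (t + z \<bullet> (p' - p)) \<le> conjugate h p'" "conjugate h p' \<le> ereal t'"
      using a by (auto simp: epi_def)
    then have "ereal (t + z \<bullet> (p' - p)) \<le> ereal t'" by (rule order_trans)
    then show "case u of (p', t') \<Rightarrow> t + z \<bullet> (p' - p) \<le> t'" by simp
  next
    fix p' assume a: "\<forall>(p', t')\<in>epi (conjugate h). t + z \<bullet> (p' - p) \<le> t'"
    show "ereal (t + z \<bullet> (p' - p)) \<le> conjugate h p'"
    proof (rule ereal_le_real)
      fix t' assume "conjugate h p' \<le> ereal t'"
      then have "(p', t') \<in> epi (conjugate h)" by (simp add: epi_def)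
      from bspec[OF a this] show "ereal (t + z \<bullet> (p' - p)) \<le> ereal t'" by simp
    qed
  qed
  then show ?thesis
    unfolding subdifferential_convex[OF convex_epi_conjugate]
    using conjugate_not_MInf[OF assms, of p] by (cases "conjugate h p") auto
qed

text \<open>This avoids the Fenchel--Moreau theorem: if \<open>(z, z \<bullet> p - t)\<close> were outside the
  epigraph of \<open>h\<close>, a separating functional averaged with \<open>p\<close> would give a point violating the
  subgradient inequality for the conjugate. The averaging covers vertical hyperplanes as well.\<close>

lemma subdifferential_conjugate_imp:
  fixes h :: "'a::euclidean_space \<Rightarrow> ereal"
  assumes h: "proper_fun h" "convex (epi h)" "closed (epi h)"
    and z: "z \<in> subdifferential (conjugate h) p"
  shows "p \<in> subdifferential h z"
proof -
  obtain t where t: "conjugate h p = ereal t"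
    and sub: "\<And>p' t'. conjugate h p' \<le> ereal t' \<Longrightarrow> t + z \<bullet> (p' - p) \<le> t'"
    using z unfolding subdifferential_conjugate_iff[OF h(1)] by (auto simp: epi_def)
  have le: "h z \<le> ereal (z \<bullet> p - t)"
  proof (rule ccontr)
    assume "\<not> ?thesis"
    then have "(z, z \<bullet> p - t) \<notin> epi h" by (simp add: epi_def)
    from separating_hyperplane_closed_point[OF h(2,3) this]
    obtain a \<beta> c where lt: "a \<bullet> z + \<beta> * (z \<bullet> p - t) < c"
      and gt: "\<And>z' s. h z' \<le> ereal s \<Longrightarrow> c < a \<bullet> z' + \<beta> * s"
      by (fastforce simp: epi_def)
    \<comment> \<open>The epigraph is closed upwards, so a negative \<beta> would violate
      \<open>gt\<close> high above \<open>z0\<close>.\<close>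
    have \<beta>: "\<beta> \<ge> 0"
    proof (rule ccontr)
      assume neg: "\<not> \<beta> \<ge> 0"
      obtain z0 s0 where z0: "h z0 = ereal s0" using proper_fun_epi_nonempty[OF h(1)] .
      define s where "s = max s0 ((a \<bullet> z0 - c) / (- \<beta>))"
      have "(a \<bullet> z0 - c) / (- \<beta>) * (- \<beta>) \<le> s * (- \<beta>)"
        using neg by (intro mult_right_mono) (auto simp: s_def)
      then have "a \<bullet> z0 - c \<le> s * (- \<beta>)" using neg by simp
      moreover have "c < a \<bullet> z0 + \<beta> * s" by (rule gt) (simp add: z0 s_def)
      ultimately show False by (simp add: mult.commute)
    qed
    \<comment> \<open>For \<beta> > 0 this averages \<open>p\<close> and
      \<open>- a / \<beta>\<close> with weights proportional to 1 and \<beta>; for \<beta> = 0, a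
      vertical hyperplane, it is \<open>p - a\<close>. The bound on the conjugate adds Fenchel-Young
      for \<open>p\<close> to \<open>gt\<close> and divides by \<open>1 + \<beta>\<close>.\<close>
    define p' where "p' = (p - a) /\<^sub>R (1 + \<beta>)"
    have "conjugate h p' \<le> ereal ((t - c) / (1 + \<beta>))"
    proof (rule epi_conjugateI)
      fix z' s assume s: "h z' \<le> ereal s"
      have "z' \<bullet> p \<le> s + t" using epi_conjugateD[of h p t z' s] t s by simp
      then have "z' \<bullet> p - z' \<bullet> a \<le> (1 + \<beta>) * s + (t - c)"
        using gt[OF s] by (simp add: algebra_simps inner_commute)
      moreover have "z' \<bullet> p' = (z' \<bullet> p - z' \<bullet> a) / (1 + \<beta>)"
        by (simp add: p'_def inner_diff_right divide_inverse mult.commute)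
      ultimately show "z' \<bullet> p' \<le> s + (t - c) / (1 + \<beta>)"
        using \<beta> by (simp add: field_simps)
    qed
    from sub[OF this] have "t + ((z \<bullet> p - z \<bullet> a) / (1 + \<beta>) - z \<bullet> p) \<le> (t - c) / (1 + \<beta>)"
      by (simp add: p'_def inner_diff_right divide_inverse mult.commute)
    then have "(1 + \<beta>) * (t + ((z \<bullet> p - z \<bullet> a) / (1 + \<beta>) - z \<bullet> p)) \<le> (1 + \<beta>) * ((t - c) / (1 + \<beta>))"
      using \<beta> by (intro mult_left_mono) auto
    moreover have "(1 + \<beta>) * ((z \<bullet> p - z \<bullet> a) / (1 + \<beta>)) = z \<bullet> p - z \<bullet> a"
      "(1 + \<beta>) * ((t - c) / (1 + \<beta>)) = t - c"
      using \<beta> by simp_all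
    ultimately have "(1 + \<beta>) * (t - z \<bullet> p) + (z \<bullet> p - z \<bullet> a) \<le> t - c"
      by (simp only: distrib_left right_diff_distrib)
    then show False using lt by (simp add: algebra_simps inner_commute)
  qed
  \<comment> \<open>One inequality is \<open>le\<close>, the other is Fenchel-Young; hence
    \<open>z\<close> and \<open>p\<close> attain equality in it.\<close>
  have hz: "h z = ereal (z \<bullet> p - t)"
  proof (cases "h z")
    case (real r)
    then show ?thesis using le epi_conjugateD[of h p t z r] t by simp
  qed (use le h(1) in \<open>auto simp: proper_fun_def\<close>)
  have "h z + ereal (p \<bullet> (z' - z)) \<le> h z'" for z'
  proof -
    have "ereal (z \<bullet> p - t + p \<bullet> (z' - z)) \<le> h z'"
    proof (rule ereal_le_real)
      fix s assume "h z' \<le> ereal s"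
      then show "ereal (z \<bullet> p - t + p \<bullet> (z' - z)) \<le> ereal s"
        using epi_conjugateD[of h p t z' s] t by (simp add: inner_diff_right inner_commute)
    qed
    then show ?thesis by (simp add: hz)
  qed
  then show ?thesis unfolding subdifferential_convex[OF h(2)] using hz by simp
qed

section \<open>Monotone sets and their regular normals\<close>

definition monotone_set :: "('a::real_inner \<times> 'a) set \<Rightarrow> bool" where
  "monotone_set M \<longleftrightarrow> (\<forall>(z, p)\<in>M. \<forall>(z', p')\<in>M. (z' - z) \<bullet> (p' - p) \<ge> 0)"

lemma monotone_graph_subdifferential:
  assumes "convex (epi h)"
  shows "monotone_set (graph (subdifferential h))"
proof -
  have "(z' - z) \<bullet> (p' - p) \<ge> 0"
    if p: "p \<in> subdifferential h z" and p': "p' \<in> subdifferential h z'" for z p z' p'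
  proof -
    obtain r r' where r: "h z = ereal r" "h z' = ereal r'"
      using p p' by (auto simp: subdifferential_def)
    have "r + p \<bullet> (z' - z) \<le> r'" "r' + p' \<bullet> (z - z') \<le> r"
      using p p' r unfolding subdifferential_convex[OF assms]
      by (auto dest: spec[of _ z'] spec[of _ z])
    then show ?thesis by (simp add: algebra_simps inner_commute)
  qed
  then show ?thesis by (auto simp: monotone_set_def graph_def)
qed

lemma regular_normal_cone_scaleR:
  assumes "u \<in> regular_normal_cone C c" "r \<ge> 0"
  shows "r *\<^sub>R u \<in> regular_normal_cone C c"
  using assms by (simp add: regular_normal_cone_def polar_cone_def mult_nonneg_nonpos)

text \<open>Monotonicity against the second point reads
  \<open>(\<tau> A - \<zeta>) \<bullet> (\<tau> B - q) \<ge> 0\<close> along any approach to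
  \<open>(z, p)\<close>. Orthogonality removes the constant term, so dividing by \<tau> and letting
  it tend to 0 leaves the first-order term, which is the normal inequality with the two increments
  swapped.\<close>

lemma regular_normal_cone_monotone_set:
  assumes M: "monotone_set M" "(z + \<zeta>, p + q) \<in> M" and "\<zeta> \<bullet> q = 0"
  shows "(q, \<zeta>) \<in> regular_normal_cone M (z, p)"
proof -
  have "(q, \<zeta>) \<bullet> (a, b) \<le> 0" if ab: "(a, b) \<in> tangent_cone M (z, p)" for a b
  proof -
    obtain cs \<tau> where cs: "\<And>k. cs k \<in> M" "\<And>k. \<tau> k > (0::real)" "\<tau> \<longlonglongrightarrow> 0"
      and lim: "(\<lambda>k. (cs k - (z, p)) /\<^sub>R \<tau> k) \<longlonglongrightarrow> (a, b)"
      using ab unfolding tangent_cone_def by blast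
    define A where "A k = (fst (cs k) - z) /\<^sub>R \<tau> k" for k
    define B where "B k = (snd (cs k) - p) /\<^sub>R \<tau> k" for k
    have A: "A \<longlonglongrightarrow> a" using tendsto_fst[OF lim] by (simp add: A_def[abs_def])
    have B: "B \<longlonglongrightarrow> b" using tendsto_snd[OF lim] by (simp add: B_def[abs_def])
    have "\<zeta> \<bullet> B k + q \<bullet> A k \<le> \<tau> k * (A k \<bullet> B k)" for k
    proof -
      have AB: "fst (cs k) = z + \<tau> k *\<^sub>R A k" "snd (cs k) = p + \<tau> k *\<^sub>R B k"
        using cs(2)[of k] by (simp_all add: A_def B_def)
      have "(fst (cs k) - (z + \<zeta>)) \<bullet> (snd (cs k) - (p + q)) \<ge> 0"
        using M cs(1)[of k] unfolding monotone_set_def by fastforce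
      then have "(\<tau> k *\<^sub>R A k - \<zeta>) \<bullet> (\<tau> k *\<^sub>R B k - q) \<ge> 0"
        unfolding AB by (simp add: algebra_simps)
      then have "\<tau> k * (\<tau> k * (A k \<bullet> B k) - (\<zeta> \<bullet> B k + q \<bullet> A k)) \<ge> 0"
        using assms(3) by (simp add: inner_diff_left inner_diff_right inner_commute algebra_simps)
      then show ?thesis using cs(2)[of k] by (simp add: zero_le_mult_iff)
    qed
    moreover have "(\<lambda>k. \<zeta> \<bullet> B k + q \<bullet> A k) \<longlonglongrightarrow> \<zeta> \<bullet> b + q \<bullet> a"
      by (intro tendsto_intros A B)
    moreover have "(\<lambda>k. \<tau> k * (A k \<bullet> B k)) \<longlonglongrightarrow> 0 * (a \<bullet> b)"
      by (intro tendsto_intros A B cs(3))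
    ultimately have "\<zeta> \<bullet> b + q \<bullet> a \<le> 0 * (a \<bullet> b)"
      by (intro LIMSEQ_le) auto
    then show ?thesis by simp
  qed
  then show ?thesis by (auto simp: regular_normal_cone_def polar_cone_def)
qed

section \<open>Solutions as a variational inequality\<close>

text \<open>The derivatives whose existence \<open>C2\<close> asserts become parameters, so that
  limits and continuity can be stated for them directly.\<close>

locale convex_composite =
  fixes g :: "(real^'n) \<times> (real^'m) \<Rightarrow> real"
    and G :: "(real^'n) \<times> (real^'m) \<Rightarrow> real^'s"
    and h :: "real^'s \<Rightarrow> ereal"
    and g' :: "(real^'n) \<times> (real^'m) \<Rightarrow> ((real^'n) \<times> (real^'m)) \<Rightarrow>\<^sub>L real"
    and g'' :: "(real^'n) \<times> (real^'m) \<Rightarrow>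
      ((real^'n) \<times> (real^'m)) \<Rightarrow>\<^sub>L (((real^'n) \<times> (real^'m)) \<Rightarrow>\<^sub>L real)"
    and G' :: "(real^'n) \<times> (real^'m) \<Rightarrow> ((real^'n) \<times> (real^'m)) \<Rightarrow>\<^sub>L (real^'s)"
    and G'' :: "(real^'n) \<times> (real^'m) \<Rightarrow>
      ((real^'n) \<times> (real^'m)) \<Rightarrow>\<^sub>L (((real^'n) \<times> (real^'m)) \<Rightarrow>\<^sub>L (real^'s))"
  assumes g': "\<And>u. (g has_derivative blinfun_apply (g' u)) (at u)"
    and g'': "\<And>u. (g' has_derivative blinfun_apply (g'' u)) (at u)"
    and cont_g'': "continuous_on UNIV g''"
    and G': "\<And>u. (G has_derivative blinfun_apply (G' u)) (at u)"
    and G'': "\<And>u. (G' has_derivative blinfun_apply (G'' u)) (at u)"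
    and cont_G'': "continuous_on UNIV G''"
    and convex_g: "\<And>x. convex_on UNIV (\<lambda>y. g (x, y))"
    and convex_G: "\<And>x i. convex_on UNIV (\<lambda>y. G (x, y) $ i)"
    and proper_h: "proper_fun h"
    and convex_h: "convex (epi h)"
    and closed_h: "closed (epi h)"
    and mono_h: "mono h"
begin

text \<open>The Lagrangian up to the conjugate term, which is constant in \<open>y\<close>:
  real-valued for all \<open>p\<close>, with the same derivatives in \<open>y\<close> wherever the
  conjugate is finite.\<close>

definition lag :: "real^'n \<Rightarrow> real^'m \<Rightarrow> real^'s \<Rightarrow> real" where
  "lag x y p = g (x, y) + G (x, y) \<bullet> p"

definition grad_lag :: "real^'n \<Rightarrow> real^'m \<Rightarrow> real^'s \<Rightarrow> real^'m" where
  "grad_lag x y p = grad_y g x y + transpose (jac_y G x y) *v p"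

text \<open>The components are the derivative of \<open>lag\<close> in \<open>y\<close>, its
  negative derivative in \<open>p\<close>, and the derivative of the epigraph variable
  \<open>t\<close>, which stands in for the nonsmooth conjugate.\<close>

definition kkt_map :: "real^'n \<Rightarrow> (real^'m) \<times> (real^'s) \<times> real \<Rightarrow> (real^'m) \<times> (real^'s) \<times> real" where
  "kkt_map x = (\<lambda>(y, p, t). (grad_lag x y p, - G (x, y), 1))"

abbreviation kkt_set :: "((real^'m) \<times> (real^'s) \<times> real) set" where
  "kkt_set \<equiv> UNIV \<times> epi (conjugate h)"

section \<open>Derivatives of the data and of the Lagrangian in \<open>y\<close>\<close>

lemma grad_y_inner: "grad_y g x y \<bullet> v = g' (x, y) (0, v)"
proof -
  have "GDERIV (\<lambda>y'. g (x, y')) y :> (\<chi> i. g' (x, y) (0, axis i 1))"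
    unfolding gderiv_def inner_commute[of _ "\<chi> i. g' (x, y) (0, axis i 1)"]
      inner_representation[OF linear_slice]
    by (rule has_derivative_slice[OF g'])
  then show ?thesis
    using inner_representation[OF linear_slice] by (simp add: grad_y_def gradient_eqI)
qed

lemma jac_y_mult: "jac_y G x y *v w = G' (x, y) (0, w)"
proof -
  have d: "((\<lambda>y'. G (x, y')) has_derivative (\<lambda>w. G' (x, y) (0, w))) (at y)"
    by (rule has_derivative_slice[OF G'])
  then have "(\<lambda>y'. G (x, y')) differentiable at y" unfolding differentiable_def by blast
  then have "((\<lambda>y'. G (x, y')) has_derivative (*v) (jac_y G x y)) (at y)"
    unfolding jac_y_def jacobian_works .
  from fun_cong[OF has_derivative_unique[OF this d]] show ?thesis .
qed

lemma transpose_jac_y_inner: "(transpose (jac_y G x y) *v p) \<bullet> w = p \<bullet> G' (x, y) (0, w)"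
  by (simp add: dot_lmul_matrix jac_y_mult del: vector_transpose_matrix)

lemma grad_lag_inner: "grad_lag x y p \<bullet> w = g' (x, y) (0, w) + p \<bullet> G' (x, y) (0, w)"
  by (simp only: grad_lag_def inner_add_left grad_y_inner transpose_jac_y_inner)

lemma has_derivative_lag:
  "((\<lambda>y. lag x y p) has_derivative (\<lambda>w. grad_lag x y p \<bullet> w)) (at y)"
  unfolding lag_def grad_lag_inner
  by (auto intro!: derivative_eq_intros has_derivative_slice[OF g'] has_derivative_slice[OF G']
      simp: inner_commute)

lemma continuous_kkt_map: "continuous_on S (\<lambda>(x, u). kkt_map x u)"
proof -
  have cont: "continuous_on UNIV g'" "continuous_on UNIV G'" "continuous_on UNIV G"
    using g'' G'' G' by (auto intro!: has_derivative_continuous_on)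
  have [continuous_intros]:
    "continuous_on S (\<lambda>v. g' (fst v, fst (snd v)))"
    "continuous_on S (\<lambda>v. G' (fst v, fst (snd v)))"
    "continuous_on S (\<lambda>v. G (fst v, fst (snd v)))"
    by (rule continuous_on_compose2[OF cont(1)] continuous_on_compose2[OF cont(2)]
        continuous_on_compose2[OF cont(3)]; auto intro!: continuous_intros)+
  have "continuous_on S (\<lambda>v. grad_lag (fst v) (fst (snd v)) (fst (snd (snd v))))"
  proof (rule continuous_on_componentwise[THEN iffD2, rule_format])
    fix b :: "real^'m"
    show "continuous_on S (\<lambda>v. grad_lag (fst v) (fst (snd v)) (fst (snd (snd v))) \<bullet> b)"
      unfolding grad_lag_inner by (intro continuous_intros)
  qed
  then show ?thesis
    unfolding kkt_map_def case_prod_unfold by (intro continuous_intros)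
qed

text \<open>Where the conjugate is finite, the Lagrangian is \<open>lag\<close> minus a constant, so
  its gradient is \<open>grad_lag\<close>; differentiating the tested form of
  \<open>grad_lag\<close> once more gives the formula.\<close>

lemma hessian_lagrangian_inner:
  assumes "\<bar>conjugate h p\<bar> \<noteq> \<infinity>"
  shows "(hessian_lagrangian g G h x y p *v w) \<bullet> v =
    g'' (x, y) (0, w) (0, v) + p \<bullet> G'' (x, y) (0, w) (0, v)"
proof -
  let ?H = "\<lambda>w. \<chi> i. g'' (x, y) (0, w) (0, axis i 1) + p \<bullet> G'' (x, y) (0, w) (0, axis i 1)"
  obtain c where c: "conjugate h p = ereal c" using assms by auto
  have "gradient (\<lambda>y'. real_of_ereal (lagrangian g G h x y' p)) y' = grad_lag x y' p" for y'
  proof (rule gradient_eqI)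
    have "((\<lambda>y'. lag x y' p - c) has_derivative (\<lambda>w. grad_lag x y' p \<bullet> w)) (at y')"
      by (auto intro!: derivative_eq_intros has_derivative_lag)
    then show "GDERIV (\<lambda>y'. real_of_ereal (lagrangian g G h x y' p)) y' :> grad_lag x y' p"
      by (simp add: gderiv_def lagrangian_def lag_def c inner_commute)
  qed
  then have H: "hessian_lagrangian g G h x y p = jacobian (\<lambda>y'. grad_lag x y' p) (at y)"
    unfolding hessian_lagrangian_def hessian_def by presburger
  have "linear (\<lambda>v. p \<bullet> G'' (x, y) (0, w) (0, v))" for w
    using linear_compose[OF linear_slice bounded_linear.linear[OF bounded_linear_inner_right]]
    by (simp add: comp_def)
  then have H_inner: "?H w \<bullet> v = g'' (x, y) (0, w) (0, v) + p \<bullet> G'' (x, y) (0, w) (0, v)" for w v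
    by (intro inner_representation linear_compose_add linear_slice)
  have d: "((\<lambda>y'. grad_lag x y' p) has_derivative ?H) (at y)"
  proof (rule has_derivative_componentwise_within[THEN iffD2, rule_format])
    fix b :: "real^'m"
    show "((\<lambda>y'. grad_lag x y' p \<bullet> b) has_derivative (\<lambda>w. ?H w \<bullet> b)) (at y)"
      unfolding grad_lag_inner H_inner
      by (intro has_derivative_add has_derivative_inner_right
          bounded_linear.has_derivative[OF bounded_linear_apply_blinfun]
          has_derivative_slice[OF g''] has_derivative_slice[OF G''])
  qed
  then have "(\<lambda>y'. grad_lag x y' p) differentiable at y" unfolding differentiable_def by blast
  then have "((\<lambda>y'. grad_lag x y' p) has_derivative (*v) (hessian_lagrangian g G h x y p)) (at y)"
    unfolding H jacobian_works .
  from fun_cong[OF has_derivative_unique[OF this d]]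
  have "hessian_lagrangian g G h x y p *v w = ?H w" .
  then show ?thesis by (simp only: H_inner)
qed

text \<open>As \<open>h\<close> is nondecreasing, \<open>p\<close> has nonnegative components, so
  \<open>lag\<close> is a nonnegative combination of functions convex in \<open>y\<close>.\<close>

lemma lag_above_tangent:
  assumes "(p, t) \<in> epi (conjugate h)"
  shows "lag x y p + grad_lag x y p \<bullet> (y' - y) \<le> lag x y' p"
proof (rule convex_on_UNIV_above_tangent[OF _ has_derivative_lag])
  have nonneg: "p $ i \<ge> 0" for i
    using mono_conjugate_nonneg[OF proper_h mono_h] assms by (auto simp: epi_def)
  have "convex_on UNIV (\<lambda>y. \<Sum>i\<in>I. p $ i * G (x, y) $ i)" if "finite I" for I
    using that
  proof induction
    case empty
    show ?case by (simp add: convex_on_const)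
  next
    case (insert i I)
    then show ?case by (simp add: convex_on_add convex_on_cmul convex_G nonneg)
  qed
  then have "convex_on UNIV (\<lambda>y. \<Sum>i\<in>UNIV. p $ i * G (x, y) $ i)" by simp
  then have "convex_on UNIV (\<lambda>y. G (x, y) \<bullet> p)"
    by (simp add: inner_vec_def mult.commute)
  then show "convex_on UNIV (\<lambda>y. lag x y p)"
    unfolding lag_def by (intro convex_on_add convex_g)
qed

text \<open>Adding the tangent inequalities at the two points bounds the contribution of
  \<open>y\<close> from below by \<open>(G (x, y) - G (x, y')) \<bullet> (p - p')\<close>, which the
  contribution of \<open>p\<close> cancels.\<close>

lemma monotone_kkt_map: "monotone_map_on kkt_set (kkt_map x)"
  unfolding monotone_map_on_def
proof (intro ballI)
  fix u v assume "u \<in> kkt_set" "v \<in> kkt_set"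
  moreover obtain y p t y' p' t' where [simp]: "u = (y, p, t)" "v = (y', p', t')"
    by (metis prod.exhaust)
  ultimately have "(p, t) \<in> epi (conjugate h)" "(p', t') \<in> epi (conjugate h)" by auto
  from lag_above_tangent[OF this(1), of x y y'] lag_above_tangent[OF this(2), of x y' y]
  show "(kkt_map x u - kkt_map x v) \<bullet> (u - v) \<ge> 0"
    by (simp add: kkt_map_def lag_def inner_diff_left inner_diff_right)
qed

section \<open>Solutions as points of the variational inequality and as saddle points\<close>

lemma solution_mapping_iff:
  "(y, p) \<in> solution_mapping g G h x \<longleftrightarrow>
    grad_lag x y p = 0 \<and> G (x, y) \<in> subdifferential (conjugate h) p"
proof -
  have "0 = - a - b \<longleftrightarrow> a + b = 0" for a b :: "real^'m"
    by (metis add.inverse_inverse diff_conv_add_uminus minus_add_distrib neg_equal_0_iff_equal)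
  moreover have "0 \<in> (\<lambda>v. - c + v) ` V \<longleftrightarrow> c \<in> V" for c :: "real^'s" and V
    by (auto simp: image_iff)
  ultimately show ?thesis by (simp add: solution_mapping_def grad_lag_def)
qed

text \<open>Varying \<open>y\<close> alone makes the gradient vanish, varying \<open>t\<close> alone
  pushes it down to the value of the conjugate, and what remains is the subgradient
  inequality.\<close>

lemma VI_kkt_iff:
  "(y, p, t) \<in> VI kkt_set (kkt_map x) \<longleftrightarrow>
    (y, p) \<in> solution_mapping g G h x \<and> conjugate h p = ereal t"
proof
  assume vi: "(y, p, t) \<in> VI kkt_set (kkt_map x)"
  then have pt: "conjugate h p \<le> ereal t" by (simp add: VI_def epi_def)
  have le: "grad_lag x y p \<bullet> (y' - y) - G (x, y) \<bullet> (p' - p) + (t' - t) \<ge> 0"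
    if "conjugate h p' \<le> ereal t'" for y' p' t'
  proof -
    have "(y', p', t') \<in> kkt_set" using that by (simp add: epi_def)
    then have "kkt_map x (y, p, t) \<bullet> ((y', p', t') - (y, p, t)) \<ge> 0"
      using vi unfolding VI_def by blast
    then show ?thesis by (simp add: kkt_map_def)
  qed
  \<comment> \<open>The test point is one full step along the negative gradient.\<close>
  have "grad_lag x y p \<bullet> - grad_lag x y p \<ge> 0"
    using le[OF pt, of "y - grad_lag x y p"] by simp
  then have grad: "grad_lag x y p = 0"
    by (metis inner_eq_zero_iff inner_ge_zero inner_minus_right neg_0_le_iff_le order_antisym)
  obtain r where r: "conjugate h p = ereal r"
    using pt conjugate_not_MInf[OF proper_h, of p] by (cases "conjugate h p") auto
  have "t = r" using le[of p r y] pt r by simp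
  moreover have "r + G (x, y) \<bullet> (p' - p) \<le> t'" if "conjugate h p' \<le> ereal t'" for p' t'
    using le[OF that, of y] \<open>t = r\<close> by simp
  ultimately show "(y, p) \<in> solution_mapping g G h x \<and> conjugate h p = ereal t"
    using r by (auto simp: solution_mapping_iff grad subdifferential_conjugate_iff[OF proper_h] epi_def)
next
  assume "(y, p) \<in> solution_mapping g G h x \<and> conjugate h p = ereal t"
  then show "(y, p, t) \<in> VI kkt_set (kkt_map x)"
    unfolding solution_mapping_iff subdifferential_conjugate_iff[OF proper_h] VI_def
    by (fastforce simp: kkt_map_def epi_def)
qed

text \<open>Solutions are saddle points of a function convex in \<open>y\<close> and concave in
  \<open>p\<close>, and the components of saddle points can be interchanged.\<close>

lemma solution_mapping_rectangle:
  assumes 1: "(y1, p1) \<in> solution_mapping g G h x" and 2: "(y2, p2) \<in> solution_mapping g G h x"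
  shows "(y1, p2) \<in> solution_mapping g G h x"
proof -
  note D = solution_mapping_iff subdifferential_conjugate_iff[OF proper_h]
  obtain t1 where t1: "conjugate h p1 = ereal t1" "grad_lag x y1 p1 = 0"
    "\<And>p' t'. (p', t') \<in> epi (conjugate h) \<Longrightarrow> t1 + G (x, y1) \<bullet> (p' - p1) \<le> t'"
    using 1 unfolding D by blast
  obtain t2 where t2: "conjugate h p2 = ereal t2" "grad_lag x y2 p2 = 0"
    "\<And>p' t'. (p', t') \<in> epi (conjugate h) \<Longrightarrow> t2 + G (x, y2) \<bullet> (p' - p2) \<le> t'"
    using 2 unfolding D by blast
  have e: "(p1, t1) \<in> epi (conjugate h)" "(p2, t2) \<in> epi (conjugate h)"
    using t1 t2 by (auto simp: epi_def)
  have min2: "lag x y2 p2 \<le> lag x y' p2" for y'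
    using lag_above_tangent[OF e(2), of x y2 y'] t2(2) by simp
  \<comment> \<open>Two minimality inequalities in \<open>y\<close> and two subgradient inequalities
    in \<open>p\<close>: their sum has equal sides, so each holds with equality.\<close>
  note ineqs = lag_above_tangent[OF e(1), of x y1 y2] t1(2) min2[of y1] t1(3)[OF e(2)] t2(3)[OF e(1)]
  have eq: "lag x y1 p2 = lag x y2 p2" "t2 = t1 + G (x, y1) \<bullet> (p2 - p1)"
    using ineqs by (auto simp: lag_def inner_diff_right)
  \<comment> \<open>\<open>y1\<close> attains the minimum over \<open>y\<close> for the multiplier
    \<open>p2\<close>, so the derivative vanishes there.\<close>
  have "(\<lambda>w. grad_lag x y1 p2 \<bullet> w) = (\<lambda>w. 0)"
    using has_derivative_lag[of x p2 y1]
  proof (rule differential_zero_maxmin[of y1 UNIV, rotated 2])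
    show "(\<forall>y\<in>UNIV. lag x y p2 \<le> lag x y1 p2) \<or> (\<forall>y\<in>UNIV. lag x y1 p2 \<le> lag x y p2)"
      using min2 eq(1) by simp
  qed auto
  then have "grad_lag x y1 p2 = 0" by (metis inner_eq_zero_iff)
  moreover have "t2 + G (x, y1) \<bullet> (p' - p2) \<le> t'" if "(p', t') \<in> epi (conjugate h)" for p' t'
    using t1(3)[OF that] eq(2) by (simp add: inner_diff_right)
  ultimately show ?thesis unfolding D using t2(1) by auto
qed

lemma solution_mapping_graph:
  assumes "(y, p) \<in> solution_mapping g G h x"
  shows "(G (x, y), p) \<in> graph (subdifferential h)"
  using subdifferential_conjugate_imp[OF proper_h convex_h closed_h] assms
  by (simp add: graph_def solution_mapping_iff)

section \<open>Local uniqueness from the second-order condition\<close>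

text \<open>Two solutions with a common multiplier differ in \<open>y\<close> only. Their normalized
  difference tends to a kernel direction of the Hessian, and the normals obtained from monotonicity
  have first component 0, so the limit fits the second-order condition with
  \<open>z = 0\<close>.\<close>

lemma primal_direction:
  assumes fin: "\<bar>conjugate h p\<bar> \<noteq> \<infinity>"
    and X: "X \<longlonglongrightarrow> x" and A: "A \<longlonglongrightarrow> y" and B: "B \<longlonglongrightarrow> y" and P: "P \<longlonglongrightarrow> p"
    and ne: "\<And>k. A k \<noteq> B k"
    and SA: "\<And>k. (A k, P k) \<in> solution_mapping g G h (X k)"
    and SB: "\<And>k. (B k, P k) \<in> solution_mapping g G h (X k)"
  obtains w where "norm w = 1" "hessian_lagrangian g G h x y p *v w = 0"
    "0 \<in> coderivative (subdifferential h) (G (x, y)) p (jac_y G x y *v w)"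
proof -
  obtain \<rho> w where \<rho>: "strict_mono \<rho>" and w: "norm w = 1"
    and lim: "(\<lambda>k. (B (\<rho> k) - A (\<rho> k)) /\<^sub>R norm (B (\<rho> k) - A (\<rho> k))) \<longlonglongrightarrow> w"
    by (rule normalized_difference_convergent_subseq[OF ne])
  define a where "a k = (X (\<rho> k), A (\<rho> k))" for k
  define b where "b k = (X (\<rho> k), B (\<rho> k))" for k
  have P\<rho>: "(\<lambda>k. P (\<rho> k)) \<longlonglongrightarrow> p"
    using LIMSEQ_subseq_LIMSEQ[OF P \<rho>] by (simp add: comp_def)
  have a: "a \<longlonglongrightarrow> (x, y)" and b: "b \<longlonglongrightarrow> (x, y)"
    unfolding a_def[abs_def] b_def[abs_def]
    using LIMSEQ_subseq_LIMSEQ[OF X \<rho>] LIMSEQ_subseq_LIMSEQ[OF A \<rho>] LIMSEQ_subseq_LIMSEQ[OF B \<rho>]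
    by (auto intro!: tendsto_Pair simp: comp_def)
  have ab: "a k \<noteq> b k" for k using ne by (auto simp: a_def b_def)
  let ?n = "\<lambda>k. norm (b k - a k)"
  \<comment> \<open>The parameters agree, so the limit direction is \<open>(0, w)\<close> and only
    derivatives in \<open>y\<close> enter.\<close>
  have "(b k - a k) /\<^sub>R ?n k = (0, (B (\<rho> k) - A (\<rho> k)) /\<^sub>R norm (B (\<rho> k) - A (\<rho> k)))" for k
    by (simp add: a_def b_def norm_Pair)
  then have d: "(\<lambda>k. (b k - a k) /\<^sub>R ?n k) \<longlonglongrightarrow> (0, w)"
    using lim by (auto intro!: tendsto_Pair)
  note quot = difference_quotient_sequence_limit[OF _ _ a b ab d]
  have cont: "isCont g'' (x, y)" "isCont G'' (x, y)" "isCont G' (x, y)" "isCont G (x, y)"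
    using cont_g'' cont_G'' has_derivative_continuous[OF G''] has_derivative_continuous[OF G']
    by (simp_all add: continuous_on_eq_continuous_at)
  have "(hessian_lagrangian g G h x y p *v w) \<bullet> v = 0" for v
  proof -
    \<comment> \<open>The tested difference of two vanishing gradients of the Lagrangian, divided by
      the distance.\<close>
    let ?q = "\<lambda>k. ((g' (b k) - g' (a k)) /\<^sub>R ?n k) (0, v) + P (\<rho> k) \<bullet> ((G' (b k) - G' (a k)) /\<^sub>R ?n k) (0, v)"
    have "?q \<longlonglongrightarrow> g'' (x, y) (0, w) (0, v) + p \<bullet> G'' (x, y) (0, w) (0, v)"
      by (intro tendsto_intros P\<rho> quot[OF g'' cont(1)] quot[OF G'' cont(2)])
    moreover have "?q k = 0" for k
    proof -
      have "?q k = (grad_lag (X (\<rho> k)) (B (\<rho> k)) (P (\<rho> k)) \<bullet> v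
          - grad_lag (X (\<rho> k)) (A (\<rho> k)) (P (\<rho> k)) \<bullet> v) /\<^sub>R ?n k"
        unfolding grad_lag_inner a_def b_def
        by (simp add: blinfun.scaleR_left blinfun.diff_left inner_diff_right algebra_simps)
      then show ?thesis using SA SB by (simp add: solution_mapping_iff)
    qed
    ultimately have "(\<lambda>k. 0) \<longlonglongrightarrow> g'' (x, y) (0, w) (0, v) + p \<bullet> G'' (x, y) (0, w) (0, v)"
      by simp
    then show ?thesis
      unfolding hessian_lagrangian_inner[OF fin] using LIMSEQ_unique[OF tendsto_const] by metis
  qed
  then have "hessian_lagrangian g G h x y p *v w = 0" by (metis inner_eq_zero_iff)
  moreover have "0 \<in> coderivative (subdifferential h) (G (x, y)) p (jac_y G x y *v w)"
  proof -
    let ?us = "\<lambda>k. (0 :: real^'s, - ((G (b k) - G (a k)) /\<^sub>R ?n k))"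
    have "?us k \<in> regular_normal_cone (graph (subdifferential h)) (G (b k), P (\<rho> k))" for k
    proof -
      have "(0, G (a k) - G (b k)) \<in> regular_normal_cone (graph (subdifferential h)) (G (b k), P (\<rho> k))"
        using solution_mapping_graph[OF SA, of "\<rho> k"]
        by (intro regular_normal_cone_monotone_set monotone_graph_subdifferential convex_h)
           (simp_all add: a_def)
      from regular_normal_cone_scaleR[OF this, of "inverse (?n k)"] show ?thesis
        by (simp add: scaleR_minus_right[symmetric] del: scaleR_minus_right)
    qed
    moreover have "(G (b k), P (\<rho> k)) \<in> graph (subdifferential h)" for k
      using solution_mapping_graph[OF SB, of "\<rho> k"] by (simp add: b_def)
    moreover have "(\<lambda>k. (G (b k), P (\<rho> k))) \<longlonglongrightarrow> (G (x, y), p)"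
      by (intro tendsto_Pair P\<rho> isCont_tendsto_compose[OF cont(4) b])
    moreover have "?us \<longlonglongrightarrow> (0, - (jac_y G x y *v w))"
      unfolding jac_y_mult by (intro tendsto_intros quot[OF G' cont(3)])
    ultimately show ?thesis
      unfolding coderivative_def normal_cone_def
      by (intro CollectI exI[of _ "\<lambda>k. (G (b k), P (\<rho> k))"] exI[of _ ?us]) auto
  qed
  ultimately show thesis using that w by blast
qed

text \<open>Two solutions with common \<open>y\<close> differ in the multiplier only. The gradient
  is affine in the multiplier, so the differences are annihilated exactly before the limit; the
  normals have second component 0, which is the case \<open>w = 0\<close> of the second-order
  condition.\<close>

lemma dual_direction:
  assumes X: "X \<longlonglongrightarrow> x" and A: "A \<longlonglongrightarrow> y" and P: "P \<longlonglongrightarrow> p" and Q: "Q \<longlonglongrightarrow> p"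
    and ne: "\<And>k. P k \<noteq> Q k"
    and SP: "\<And>k. (A k, P k) \<in> solution_mapping g G h (X k)"
    and SQ: "\<And>k. (A k, Q k) \<in> solution_mapping g G h (X k)"
  obtains q where "norm q = 1" "transpose (jac_y G x y) *v q = 0"
    "q \<in> coderivative (subdifferential h) (G (x, y)) p 0"
proof -
  obtain \<rho> q where \<rho>: "strict_mono \<rho>" and q: "norm q = 1"
    and lim: "(\<lambda>k. (Q (\<rho> k) - P (\<rho> k)) /\<^sub>R norm (Q (\<rho> k) - P (\<rho> k))) \<longlonglongrightarrow> q"
    by (rule normalized_difference_convergent_subseq[OF ne])
  define a where "a k = (X (\<rho> k), A (\<rho> k))" for k
  define d where "d k = (Q (\<rho> k) - P (\<rho> k)) /\<^sub>R norm (Q (\<rho> k) - P (\<rho> k))" for k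
  have d: "d \<longlonglongrightarrow> q" using lim by (simp add: d_def[abs_def])
  have P\<rho>: "(\<lambda>k. P (\<rho> k)) \<longlonglongrightarrow> p"
    using LIMSEQ_subseq_LIMSEQ[OF P \<rho>] by (simp add: comp_def)
  have a: "a \<longlonglongrightarrow> (x, y)"
    unfolding a_def[abs_def]
    using LIMSEQ_subseq_LIMSEQ[OF X \<rho>] LIMSEQ_subseq_LIMSEQ[OF A \<rho>]
    by (auto intro!: tendsto_Pair simp: comp_def)
  have cont: "isCont G' (x, y)" "isCont G (x, y)"
    using has_derivative_continuous[OF G''] has_derivative_continuous[OF G'] by auto
  have "(transpose (jac_y G x y) *v q) \<bullet> v = 0" for v
  proof -
    have "(\<lambda>k. d k \<bullet> G' (a k) (0, v)) \<longlonglongrightarrow> q \<bullet> G' (x, y) (0, v)"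
      by (intro tendsto_intros d isCont_tendsto_compose[OF cont(1) a])
    moreover have "d k \<bullet> G' (a k) (0, v) = 0" for k
    proof -
      have "d k \<bullet> G' (a k) (0, v) = (grad_lag (X (\<rho> k)) (A (\<rho> k)) (Q (\<rho> k)) \<bullet> v
          - grad_lag (X (\<rho> k)) (A (\<rho> k)) (P (\<rho> k)) \<bullet> v) / norm (Q (\<rho> k) - P (\<rho> k))"
        unfolding grad_lag_inner a_def d_def
        by (simp add: inner_diff_left divide_inverse mult.commute)
      then show ?thesis using SP SQ by (simp add: solution_mapping_iff)
    qed
    ultimately have "(\<lambda>k. 0) \<longlonglongrightarrow> q \<bullet> G' (x, y) (0, v)" by simp
    then show ?thesis
      unfolding transpose_jac_y_inner using LIMSEQ_unique[OF tendsto_const] by metis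
  qed
  then have "transpose (jac_y G x y) *v q = 0" by (metis inner_eq_zero_iff)
  moreover have "q \<in> coderivative (subdifferential h) (G (x, y)) p 0"
  proof -
    have "(d k, 0) \<in> regular_normal_cone (graph (subdifferential h)) (G (a k), P (\<rho> k))" for k
    proof -
      have "(Q (\<rho> k) - P (\<rho> k), 0)
          \<in> regular_normal_cone (graph (subdifferential h)) (G (a k), P (\<rho> k))"
        using solution_mapping_graph[OF SQ, of "\<rho> k"]
        by (intro regular_normal_cone_monotone_set monotone_graph_subdifferential convex_h)
           (simp_all add: a_def)
      from regular_normal_cone_scaleR[OF this, of "inverse (norm (Q (\<rho> k) - P (\<rho> k)))"]
      show ?thesis by (simp add: d_def)
    qed
    moreover have "(G (a k), P (\<rho> k)) \<in> graph (subdifferential h)" for k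
      using solution_mapping_graph[OF SP, of "\<rho> k"] by (simp add: a_def)
    moreover have "(\<lambda>k. (G (a k), P (\<rho> k))) \<longlonglongrightarrow> (G (x, y), p)"
      by (intro tendsto_Pair P\<rho> isCont_tendsto_compose[OF cont(2) a])
    moreover have "(\<lambda>k. (d k, 0)) \<longlonglongrightarrow> (q, 0 :: real^'s)"
      by (intro tendsto_intros d)
    ultimately show ?thesis
      unfolding coderivative_def normal_cone_def
      by (intro CollectI exI[of _ "\<lambda>k. (G (a k), P (\<rho> k))"] exI[of _ "\<lambda>k. (d k, 0)"]) auto
  qed
  ultimately show thesis using that q by blast
qed

lemma solution_mapping_locally_unique:
  assumes fin: "\<bar>conjugate h p\<bar> \<noteq> \<infinity>"
    and soc: "\<And>w z. - (transpose (jac_y G x y) *v z) = hessian_lagrangian g G h x y p *v w \<Longrightarrow>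
              z \<in> coderivative (subdifferential h) (G (x, y)) p (jac_y G x y *v w) \<Longrightarrow>
              w = 0 \<and> z = 0"
  obtains e where "e > 0"
    "\<And>x' y1 p1 y2 p2. dist x x' < e \<Longrightarrow>
      (y1, p1) \<in> solution_mapping g G h x' \<Longrightarrow> (y2, p2) \<in> solution_mapping g G h x' \<Longrightarrow>
      dist y y1 < e \<Longrightarrow> dist p p1 < e \<Longrightarrow> dist y y2 < e \<Longrightarrow> dist p p2 < e \<Longrightarrow> (y1, p1) = (y2, p2)"
proof -
  define close where "close e x' y1 p1 y2 p2 \<longleftrightarrow> dist x x' < e \<and>
      (y1, p1) \<in> solution_mapping g G h x' \<and> (y2, p2) \<in> solution_mapping g G h x' \<and>
      dist y y1 < e \<and> dist p p1 < e \<and> dist y y2 < e \<and> dist p p2 < e" for e x' y1 p1 y2 p2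
  have y: "\<exists>e>0. \<forall>x' y1 y2 p1. close e x' y1 p1 y2 p1 \<longrightarrow> y1 = y2"
  proof (rule ccontr)
    assume neg: "\<not> ?thesis"
    have "\<exists>x' y1 y2 p1. close (inverse (real (Suc k))) x' y1 p1 y2 p1 \<and> y1 \<noteq> y2" for k
    proof -
      have "inverse (real (Suc k)) > 0" by simp
      with neg show ?thesis by blast
    qed
    then obtain X A B P where k: "\<And>k. close (inverse (real (Suc k))) (X k) (A k) (P k) (B k) (P k)"
      "\<And>k. A k \<noteq> B k" by metis
    have lim: "X \<longlonglongrightarrow> x" "A \<longlonglongrightarrow> y" "B \<longlonglongrightarrow> y" "P \<longlonglongrightarrow> p"
      using k(1) unfolding close_def by (auto intro!: LIMSEQ_of_dist_less)
    have S: "(A k, P k) \<in> solution_mapping g G h (X k)" "(B k, P k) \<in> solution_mapping g G h (X k)" for k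
      using k(1)[of k] by (auto simp: close_def)
    obtain w where "norm w = 1" "hessian_lagrangian g G h x y p *v w = 0"
      "0 \<in> coderivative (subdifferential h) (G (x, y)) p (jac_y G x y *v w)"
      by (rule primal_direction[OF fin lim k(2) S])
    with soc[of 0 w] show False by simp
  qed
  have p: "\<exists>e>0. \<forall>x' y1 p1 p2. close e x' y1 p1 y1 p2 \<longrightarrow> p1 = p2"
  proof (rule ccontr)
    assume neg: "\<not> ?thesis"
    have "\<exists>x' y1 p1 p2. close (inverse (real (Suc k))) x' y1 p1 y1 p2 \<and> p1 \<noteq> p2" for k
    proof -
      have "inverse (real (Suc k)) > 0" by simp
      with neg show ?thesis by blast
    qed
    then obtain X A P Q where k: "\<And>k. close (inverse (real (Suc k))) (X k) (A k) (P k) (A k) (Q k)"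
      "\<And>k. P k \<noteq> Q k" by metis
    have lim: "X \<longlonglongrightarrow> x" "A \<longlonglongrightarrow> y" "P \<longlonglongrightarrow> p" "Q \<longlonglongrightarrow> p"
      using k(1) unfolding close_def by (auto intro!: LIMSEQ_of_dist_less)
    have S: "(A k, P k) \<in> solution_mapping g G h (X k)" "(A k, Q k) \<in> solution_mapping g G h (X k)" for k
      using k(1)[of k] by (auto simp: close_def)
    obtain q where "norm q = 1" "transpose (jac_y G x y) *v q = 0"
      "q \<in> coderivative (subdifferential h) (G (x, y)) p 0"
      by (rule dual_direction[OF lim k(2) S])
    with soc[of q 0] show False by simp
  qed
  obtain e1 e2 where e1: "e1 > 0" "\<And>x' y1 y2 p1. close e1 x' y1 p1 y2 p1 \<Longrightarrow> y1 = y2"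
    and e2: "e2 > 0" "\<And>x' y1 p1 p2. close e2 x' y1 p1 y1 p2 \<Longrightarrow> p1 = p2"
    using y p by blast
  show thesis
  proof (rule that[of "min e1 e2"])
    fix x' y1 p1 y2 p2
    assume *: "dist x x' < min e1 e2"
      "(y1, p1) \<in> solution_mapping g G h x'" "(y2, p2) \<in> solution_mapping g G h x'"
      "dist y y1 < min e1 e2" "dist p p1 < min e1 e2" "dist y y2 < min e1 e2" "dist p p2 < min e1 e2"
    \<comment> \<open>The mixed pair shares \<open>y1\<close> with the first solution and
      \<open>p2\<close> with the second, so the two special cases suffice.\<close>
    have "(y1, p2) \<in> solution_mapping g G h x'" by (rule solution_mapping_rectangle[OF *(2,3)])
    then have "close e2 x' y1 p1 y1 p2" "close e1 x' y1 p2 y2 p2" using * by (auto simp: close_def)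
    then show "(y1, p1) = (y2, p2)" using e1(2) e2(2) by blast
  qed (use e1 e2 in simp)
qed

text \<open>Solution pairs correspond to solutions of the variational inequality by adjoining the
  value of the conjugate, so local uniqueness of pairs is the hypothesis on triples that
  \<open>VI_unique_near\<close> requires.\<close>

theorem solution_mapping_single_valued_near:
  assumes sol: "(y, p) \<in> solution_mapping g G h x"
    and soc: "\<And>w z. - (transpose (jac_y G x y) *v z) = hessian_lagrangian g G h x y p *v w \<Longrightarrow>
              z \<in> coderivative (subdifferential h) (G (x, y)) p (jac_y G x y *v w) \<Longrightarrow>
              w = 0 \<and> z = 0"
  shows "\<exists>U. open U \<and> x \<in> U \<and> (\<forall>x'\<in>U. \<exists>q. solution_mapping g G h x' = {q})"
proof -
  obtain t where t: "conjugate h p = ereal t"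
    using sol unfolding solution_mapping_iff subdifferential_conjugate_iff[OF proper_h] by blast
  then have "\<bar>conjugate h p\<bar> \<noteq> \<infinity>" by simp
  from solution_mapping_locally_unique[OF this soc]
  obtain e where e: "e > 0"
    "\<And>x' y1 p1 y2 p2. dist x x' < e \<Longrightarrow>
      (y1, p1) \<in> solution_mapping g G h x' \<Longrightarrow> (y2, p2) \<in> solution_mapping g G h x' \<Longrightarrow>
      dist y y1 < e \<Longrightarrow> dist p p1 < e \<Longrightarrow> dist y y2 < e \<Longrightarrow> dist p p2 < e \<Longrightarrow> (y1, p1) = (y2, p2)"
    by blast
  have "\<exists>U. open U \<and> x \<in> U \<and> (\<forall>x'\<in>U. \<exists>!u. u \<in> VI kkt_set (kkt_map x'))"
  proof (rule VI_unique_near[OF _ _ continuous_kkt_map monotone_kkt_map _ e(1)])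
    show "convex kkt_set" "closed kkt_set"
      by (simp_all add: convex_Times convex_epi_conjugate closed_Times closed_epi_conjugate)
    show "(y, p, t) \<in> VI kkt_set (kkt_map x)" using sol t by (simp add: VI_kkt_iff)
    fix x' u v
    assume *: "dist x x' < e" "u \<in> VI kkt_set (kkt_map x')" "v \<in> VI kkt_set (kkt_map x')"
      "dist (y, p, t) u < e" "dist (y, p, t) v < e"
    obtain y1 p1 t1 where u: "u = (y1, p1, t1)" by (rule prod_cases3)
    obtain y2 p2 t2 where v: "v = (y2, p2, t2)" by (rule prod_cases3)
    note uv = u v
    have "dist y y1 < e" "dist p p1 < e" if "dist (y, p, t) (y1, p1, t1) < e" for y1 p1 t1
      using that dist_fst_le[of "(y, p, t)" "(y1, p1, t1)"] dist_snd_le[of "(y, p, t)" "(y1, p1, t1)"]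
        dist_fst_le[of "(p, t)" "(p1, t1)"] by auto
    note d = this[OF *(4)[unfolded uv]] this[OF *(5)[unfolded uv]]
    have "(y1, p1) = (y2, p2)"
      using e(2)[OF *(1) _ _ d] *(2,3) by (simp add: uv VI_kkt_iff)
    \<comment> \<open>The third components agree too, both being the value of the conjugate at the
      common multiplier.\<close>
    then show "u = v" using *(2,3) by (simp add: uv VI_kkt_iff)
  qed
  then obtain U where U: "open U" "x \<in> U" "\<forall>x'\<in>U. \<exists>!u. u \<in> VI kkt_set (kkt_map x')"
    by (elim exE conjE)
  have "\<exists>q. solution_mapping g G h x' = {q}" if x': "x' \<in> U" for x'
  proof -
    obtain u0 where u0: "u0 \<in> VI kkt_set (kkt_map x')"
      and uniq: "\<And>u. u \<in> VI kkt_set (kkt_map x') \<Longrightarrow> u = u0"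
      using bspec[OF U(3) x'] by (elim ex1E) blast
    obtain y1 p1 t1 where u0_eq: "u0 = (y1, p1, t1)" by (rule prod_cases3)
    have "(y2, p2) = (y1, p1)" if S2: "(y2, p2) \<in> solution_mapping g G h x'" for y2 p2
    proof -
      obtain t2 where "conjugate h p2 = ereal t2"
        using S2 unfolding solution_mapping_iff subdifferential_conjugate_iff[OF proper_h] by blast
      then show ?thesis using uniq[of "(y2, p2, t2)"] S2 by (simp add: VI_kkt_iff u0_eq)
    qed
    then have only: "u = (y1, p1)" if "u \<in> solution_mapping g G h x'" for u
      using that by (cases u) simp
    have "(y1, p1) \<in> solution_mapping g G h x'" using u0 by (simp add: VI_kkt_iff u0_eq)
    then have "solution_mapping g G h x' = {(y1, p1)}"
      by (intro equalityI subsetI singletonI) (drule only, simp, simp only: singleton_iff)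
    then show ?thesis by (rule exI)
  qed
  with U(1,2) show ?thesis by (intro exI[of _ U] conjI ballI)
qed

end

theorem theorem3p5:
  fixes g :: "(real^'n) \<times> (real^'m) \<Rightarrow> real"
    and G :: "(real^'n) \<times> (real^'m) \<Rightarrow> real^'s"
    and h :: "real^'s \<Rightarrow> ereal"
    and x :: "real^'n" and y :: "real^'m" and p :: "real^'s"
  assumes "C2 g" and "C2 G"
    and "\<And>x'. convex_on UNIV (\<lambda>y'. g (x', y'))"
    and "\<And>x' i. convex_on UNIV (\<lambda>y'. G (x', y') $ i)"
    and "proper_fun h" and "polyhedron (epi h)" and "mono h"
    and "(y, p) \<in> solution_mapping g G h x"
    and basic_qualification:
      "\<And>u. u \<in> horizon_subdifferential h (G (x, y)) \<Longrightarrow>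
            transpose (jac_y G x y) *v u = 0 \<Longrightarrow> u = 0"
    and second_order_condition:
      "\<And>w z. - (transpose (jac_y G x y) *v z) = hessian_lagrangian g G h x y p *v w \<Longrightarrow>
              z \<in> coderivative (subdifferential h) (G (x, y)) p (jac_y G x y *v w) \<Longrightarrow>
              w = 0 \<and> z = 0"
  shows "\<exists>U. open U \<and> x \<in> U \<and> (\<forall>x'\<in>U. \<exists>q. solution_mapping g G h x' = {q})"
proof -
  obtain g' g'' where "\<And>u. (g has_derivative blinfun_apply (g' u)) (at u)"
    "\<And>u. (g' has_derivative blinfun_apply (g'' u)) (at u)" "continuous_on UNIV g''"
    using assms(1) unfolding C2_def by blast
  note g = this
  obtain G' G'' where "\<And>u. (G has_derivative blinfun_apply (G' u)) (at u)"
    "\<And>u. (G' has_derivative blinfun_apply (G'' u)) (at u)" "continuous_on UNIV G''"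
    using assms(2) unfolding C2_def by blast
  note G = this
  interpret convex_composite g G h g' g'' G' G''
    by unfold_locales
      (fact g G assms(3-5,7) polyhedron_imp_convex[OF assms(6)] polyhedron_imp_closed[OF assms(6)])+
  show ?thesis
    using solution_mapping_single_valued_near[OF assms(8) second_order_condition] .
qed

end
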